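(* Let $m>2$ be a fixed integer and, for positive integers $n$, let $\Sigma_{m,n}$ be the (finite) set of all partitions of the integers $k\le n$ into exactly $m$ odd prime parts, equipped with the uniform probability measure $\mathbb{P}$. Let $X_{m,n}$ be the size (the integer being partitioned) of a partition selected uniformly at random from $\Sigma_{m,n}$. Then for every $0<u<1$, $$\lim_{n\to\infty}\mathbb{P}\left(\frac{X_{m,n}}{n}\le u\right)=u^m.$$
   Context: A partition of a positive integer $k$ into $m$ odd prime parts is an unordered multiset of $m$ odd primes whose sum is $k$; its size is $k$. *)

theory Defs
  imports
    "HOL-Probability.Probability"
    "HOL-Library.Multiset"
    "HOL-Computational_Algebra.Primes"
begin

definition odd_prime_partitions :: "nat \<Rightarrow> nat \<Rightarrow> nat multiset set" where
  "odd_prime_partitions m k =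
     {\<sigma>. size \<sigma> = m \<and> (\<forall>p \<in># \<sigma>. prime p \<and> odd p) \<and> \<Sum>\<^sub># \<sigma> = k}"

definition odd_prime_partitions_upto :: "nat \<Rightarrow> nat \<Rightarrow> nat multiset set" where
  "odd_prime_partitions_upto m n = (\<Union>k \<in> {1..n}. odd_prime_partitions m k)"

text \<open>
  The two lemmas below show that \<^term>\<open>pmf_of_set (odd_prime_partitions_upto m n)\<close> is the
  uniform distribution on \<^term>\<open>odd_prime_partitions_upto m n\<close> for all large \<^term>\<open>n\<close>:
  \<^const>\<open>pmf_of_set\<close> is unspecified on empty and on infinite sets.
\<close>

lemma finite_odd_prime_partitions_upto: "finite (odd_prime_partitions_upto m n)"
proof (rule finite_subset)
  show "odd_prime_partitions_upto m n \<subseteq> mset ` {xs. set xs \<subseteq> {..n} \<and> length xs = m}"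
  proof
    fix \<sigma> assume "\<sigma> \<in> odd_prime_partitions_upto m n"
    then have size: "size \<sigma> = m" and sum: "\<Sum>\<^sub># \<sigma> \<le> n"
      by (auto simp: odd_prime_partitions_upto_def odd_prime_partitions_def)
    obtain xs where xs: "\<sigma> = mset xs" using ex_mset[of \<sigma>] by auto
    have "set xs \<subseteq> {..n}"
    proof
      fix p assume "p \<in> set xs"
      then have "p \<in># \<sigma>" by (simp add: xs)
      then have "p \<le> \<Sum>\<^sub># \<sigma>" by (simp add: sum_mset.remove)
      with sum show "p \<in> {..n}" by simp
    qed
    moreover have "length xs = m" using size by (simp add: xs)
    ultimately show "\<sigma> \<in> mset ` {xs. set xs \<subseteq> {..n} \<and> length xs = m}"
      using xs by blast
  qed
  show "finite (mset ` {xs. set xs \<subseteq> {..n} \<and> length xs = m})"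
    by (intro finite_imageI finite_lists_length_eq) simp
qed

lemma odd_prime_partitions_upto_nonempty:
  assumes "0 < m" and "3 * m \<le> n"
  shows "odd_prime_partitions_upto m n \<noteq> {}"
proof -
  have "prime (3::nat)" by simp
  then have "replicate_mset m 3 \<in> odd_prime_partitions m (3 * m)"
    by (auto simp: odd_prime_partitions_def split: if_splits)
  then show ?thesis
    using assms by (force simp: odd_prime_partitions_upto_def)
qed

end

theory Submission
  imports
    Defs
    "HOL-Complex_Analysis.Complex_Analysis"
    "HOL-Number_Theory.Prime_Powers"
    "HOL-Combinatorics.Multiset_Permutations"
    "HOL-Real_Asymp.Real_Asymp"
begin

text \<open>
  The limit law is a consequence of the prime number theorem (and conversely implies it), which is
  proved by Newman's method. The function \<open>Z(s) = (s - 1) \<zeta>(s)\<close> extends holomorphically to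
  \<open>Re s > 0\<close> and has no zeros on \<open>Re s \<ge> 1\<close>, by \<open>3 + 4 cos x + cos 2x \<ge> 0\<close> applied to
  \<open>-\<zeta>'/\<zeta> = \<Sum> \<Lambda>(n) n\<^bsup>-s\<^esup>\<close>. Hence the Dirichlet series with the coefficients
  \<open>(\<psi>(n) - n) / n\<close>, which are bounded by Chebyshev's estimate, extends holomorphically to the line
  \<open>Re s = 1\<close>, and Newman's Tauberian theorem makes \<open>\<Sum> (\<psi>(n) - n) / n\<^sup>2\<close> converge. As \<open>\<psi>\<close> is
  monotone, this forces \<open>\<psi>(n) \<sim> n\<close>, and then \<open>\<pi>(n) \<sim> n / ln n\<close>.

  If every odd prime carries the weight \<open>ln N\<close>, the total weight up to \<open>j\<close> is \<open>j + o(N)\<close>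
  uniformly in \<open>j \<le> N\<close>, as if every positive integer had weight \<open>1\<close>. By induction on \<open>m\<close>, the
  number of \<open>m\<close>-tuples of odd primes with sum at most \<open>N\<close> is therefore asymptotic to
  \<open>(N choose m) / (ln N)\<^sup>m\<close>. Almost all of these tuples have distinct entries, so dividing by
  \<open>m!\<close> counts the partitions up to a factor tending to \<open>1\<close>.
\<close>

section \<open>Newman's Tauberian theorem\<close>

text \<open>The law needs only the shape of the count: if the partitions of size at most
  \<open>n\<close> number about \<open>c n^m / (ln n)^m\<close>, then the counts at
  \<open>u n\<close> and at \<open>n\<close> have a quotient tending to \<open>u^m\<close>, because
  \<open>ln (u n) / ln n\<close> tends to 1. The Tauberian theorem asks for bounded coefficients,
  which is why it is fed \<open>(psi(n) - n) / n\<close> and not \<open>mangoldt n - 1\<close>; the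
  price is an Abel summation and Chebyshev's bound. Its discrete form works with the partial sums of
  the Dirichlet series themselves, so that no Laplace transform of \<open>psi\<close> occurs. The
  obstacle in the counting is that an m-fold sum contains inner sums over all shorter ranges, down
  to ranges where the prime number theorem says nothing. Errors are therefore measured against the
  fixed \<open>N\<close>, not against the length \<open>j\<close> of the range: with the constant
  weight \<open>ln N\<close>, a bounded range contributes at most a multiple of \<open>ln N\<close>,
  which is \<open>o(N)\<close>.\<close>

lemma powr_Suc_diff_mvt:
  fixes k p :: real
  assumes "k > 0"
  obtains \<xi> where "k < \<xi>" "\<xi> < k + 1" "(k + 1) powr p - k powr p = p * \<xi> powr (p - 1)"
proof -
  have "\<exists>z. z > k \<and> z < k + 1 \<and>
      (k + 1) powr p - k powr p = (k + 1 - k) * (p * z powr (p - 1))"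
    by (rule MVT2) (use assms in \<open>auto intro!: derivative_eq_intros simp: powr_diff\<close>)
  then show ?thesis using that by auto
qed

text \<open>By the mean value theorem each term is at most the decrease of
  \<open>t powr (-x) / x\<close> over the preceding unit interval, and these decreases
  telescope.\<close>

lemma sum_powr_tail_le:
  fixes x :: real
  assumes "1 \<le> N" "N \<le> M" "x > 0"
  shows "(\<Sum>n=Suc N..M. real n powr (-1 - x)) \<le> (real N powr (-x) - real M powr (-x)) / x"
  using assms(2)
proof (induction M rule: dec_induct)
  case base
  then show ?case by simp
next
  case (step M)
  have "real M > 0" using step assms by simp
  then obtain \<xi> where \<xi>: "real M < \<xi>" "\<xi> < real M + 1"
    "(real M + 1) powr (-x) - real M powr (-x) = (-x) * \<xi> powr (-x - 1)"
    by (rule powr_Suc_diff_mvt)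
  have "(real M + 1) powr (-1 - x) \<le> \<xi> powr (-x - 1)"
    using \<xi> assms \<open>real M > 0\<close> powr_mono2'[of "-1 - x" \<xi> "real M + 1"]
    by (simp add: add.commute minus_diff_commute)
  then have "x * (real M + 1) powr (-1 - x) \<le> x * \<xi> powr (-x - 1)"
    using assms by (intro mult_left_mono) auto
  then have "(real M + 1) powr (-1 - x) \<le> (real M powr (-x) - (real M + 1) powr (-x)) / x"
    unfolding pos_le_divide_eq[OF assms(3)] using \<xi>(3) by (simp add: mult.commute)
  then have "(\<Sum>n=Suc N..Suc M. real n powr (-1 - x)) \<le>
     (real N powr (-x) - real M powr (-x)) / x + (real M powr (-x) - (real M + 1) powr (-x)) / x"
    using step by (simp add: add.commute)
  also have "\<dots> = (real N powr (-x) - real (Suc M) powr (-x)) / x"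
    by (simp add: add.commute diff_divide_distrib)
  finally show ?case .
qed

text \<open>Comparison with the integral of \<open>t powr (y - 1)\<close>, whose monotonicity
  changes at \<open>y = 1\<close>. For \<open>y < 1\<close> the integral alone bounds the sum; for
  \<open>y >= 1\<close> each term is compared with the following interval, and the last term is left
  over.\<close>

lemma sum_powr_head_le:
  fixes y :: real
  assumes "1 \<le> N" "y > 0"
  shows "(\<Sum>n=1..N. real n powr (y - 1)) \<le> real N powr y / y + real N powr (y - 1)"
proof (cases "y \<ge> 1")
  case True
  show ?thesis using assms(1)
  proof (induction N rule: dec_induct)
    case base
    then show ?case using assms by simp
  next
    case (step N)
    have "real N > 0" using step by simp
    then obtain \<xi> where \<xi>: "real N < \<xi>" "\<xi> < real N + 1"
      "(real N + 1) powr y - real N powr y = y * \<xi> powr (y - 1)"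
      by (rule powr_Suc_diff_mvt)
    have "real N powr (y - 1) \<le> \<xi> powr (y - 1)"
      using \<xi> True by (intro powr_mono2) auto
    then have "real N powr y / y + real N powr (y - 1) \<le> (real N + 1) powr y / y"
      using \<xi>(3) assms by (simp add: field_simps)
    then show ?case using step by (simp add: add.commute)
  qed
next
  case False
  have "(\<Sum>n=1..N. real n powr (y - 1)) \<le> real N powr y / y" using assms(1)
  proof (induction N rule: dec_induct)
    case base
    then show ?case using assms False by simp
  next
    case (step N)
    have "real N > 0" using step by simp
    then obtain \<xi> where \<xi>: "real N < \<xi>" "\<xi> < real N + 1"
      "(real N + 1) powr y - real N powr y = y * \<xi> powr (y - 1)"
      by (rule powr_Suc_diff_mvt)
    have "(real N + 1) powr (y - 1) \<le> \<xi> powr (y - 1)"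
      using \<xi> False \<open>real N > 0\<close> by (intro powr_mono2') auto
    then have "real N powr y / y + (real N + 1) powr (y - 1) \<le> (real N + 1) powr y / y"
      using \<xi>(3) assms by (simp add: field_simps)
    then show ?case using step by (simp add: add.commute)
  qed
  then show ?thesis by (simp add: add_increasing2)
qed

lemma norm_of_nat_powr: "n > 0 \<Longrightarrow> norm (of_nat n powr z :: complex) = real n powr Re z"
  by (metis of_nat_0_le_iff norm_powr_real_powr of_real_of_nat_eq of_nat_0_less_iff Reals_of_nat Re_complex_of_real)

text \<open>At \<open>a\<close> the factor \<open>exp (L * z)\<close> has modulus 1, so the maximum
  of the integrand gives no decay in \<open>L\<close>. At parameter \<open>x\<close> the modulus is
  \<open>exp (- (\<delta> * L * x))\<close>, and integrating this over the unit interval yields the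
  factor \<open>1 / (\<delta> * L)\<close>.\<close>

lemma contour_integral_linepath_exp_bound:
  fixes a b :: complex
  assumes "continuous_on (closed_segment a b) F"
    and M: "\<And>z. z \<in> closed_segment a b \<Longrightarrow> norm (F z) \<le> M"
    and "Re a = 0" "Re b = -\<delta>" "\<delta> > 0" "L > 0"
  shows "norm (contour_integral (linepath a b) (\<lambda>z. F z * exp (of_real L * z)))
           \<le> M * norm (b - a) / (\<delta> * L)"
proof -
  let ?f = "\<lambda>z. F z * exp (of_real L * z)"
  let ?I = "contour_integral (linepath a b) ?f"
  have "?f contour_integrable_on linepath a b"
    by (intro contour_integrable_continuous_linepath continuous_intros assms)
  then have hc: "(?f has_contour_integral ?I) (linepath a b)"
    by (rule has_contour_integral_integral)
  then have 1: "((\<lambda>x. ?f (linepath a b x) * (b - a)) has_integral ?I) {0..1}"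
    by (simp add: has_contour_integral_linepath)
  define G where "G = (\<lambda>x. - (M * norm (b - a) / (\<delta> * L)) * exp (- (\<delta> * L * x)))"
  have "((\<lambda>x. M * norm (b - a) * exp (- (\<delta> * L * x))) has_integral (G 1 - G 0)) {0..1}"
  proof (rule fundamental_theorem_of_calculus)
    show "(G has_vector_derivative M * norm (b - a) * exp (- (\<delta> * L * x))) (at x within {0..1})" for x
      unfolding G_def has_real_derivative_iff_has_vector_derivative [symmetric]
      by (rule derivative_eq_intros refl | use assms in \<open>simp add: field_simps\<close>)+
  qed simp
  then have 2: "norm ?I \<le> G 1 - G 0"
  proof (rule has_integral_norm_bound_integral_component[OF 1, of _ _ "1::real", simplified inner_real_def mult_1_right])
    fix x :: real assume x: "x \<in> {0..1}"
    have "linepath a b x \<in> closed_segment a b"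
      using x by (auto simp: linepath_in_path)
    then have F: "norm (F (linepath a b x)) \<le> M" by (rule M)
    have "Re (linepath a b x) = - (\<delta> * x)"
      using assms by (simp add: linepath_def)
    then have e: "norm (exp (of_real L * linepath a b x)) = exp (- (\<delta> * L * x))"
      by (simp add: mult_ac)
    have "norm (?f (linepath a b x) * (b - a)) = norm (F (linepath a b x)) * (norm (b - a) * exp (- (\<delta> * L * x)))"
      unfolding norm_mult e by (simp only: mult_ac)
    also have "\<dots> \<le> M * (norm (b - a) * exp (- (\<delta> * L * x)))"
      using F by (intro mult_right_mono) auto
    finally show "norm (?f (linepath a b x) * (b - a)) \<le> M * norm (b - a) * exp (- (\<delta> * L * x))"
      by (simp only: mult.assoc)
  qed
  have "M \<ge> 0" using M[of a] norm_ge_zero[of "F a"] by (meson dual_order.trans ends_in_segment(1))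
  then have "G 1 - G 0 \<le> M * norm (b - a) / (\<delta> * L)"
    unfolding G_def using assms by simp
  with 2 show ?thesis by linarith
qed

text \<open>On the circle \<open>1 / z\<close> is \<open>cnj z / R^2\<close>, and
  \<open>z + cnj z\<close> is real.\<close>

lemma inverse_add_scaled_on_circle:
  assumes "norm z = R" "R > 0"
  shows "1 / z + z / of_real R ^ 2 = of_real (2 * Re z / R ^ 2)"
proof -
  have "z \<noteq> 0" using assms by auto
  have "of_real R ^ 2 = z * cnj z" using assms complex_norm_square[of z] by simp
  then have "1 / z = cnj z / of_real R ^ 2" using \<open>z \<noteq> 0\<close> by simp
  then show ?thesis by (simp add: add_divide_distrib[symmetric] complex_add_cnj add.commute)
qed

text \<open>
  With \<open>S\<close> the \<open>N\<close>-th partial sum and \<open>K(z) = N\<^sup>z (1/z + z/R\<^sup>2)\<close>, Cauchy's formula on \<open>|z| = R\<close>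
  gives \<open>2\<pi>\<i> S(0)\<close> as the integral of \<open>S K\<close>. As \<open>g(0) = 0\<close>, the function \<open>g K\<close> is holomorphic,
  so on the right half of the circle \<open>S\<close> may be replaced by \<open>S - g\<close> at the cost of an integral of
  \<open>g K\<close> over a path in the left half-plane, where \<open>N\<^sup>z\<close> is small. On the circle \<open>K\<close> equals
  \<open>2 N\<^sup>z Re z / R\<^sup>2\<close>, which compensates the bounds of order \<open>N\<^bsup>-Re z\<^esup> / |Re z|\<close> for \<open>S - g\<close> and \<open>S\<close>.
\<close>

lemma newman_key_bound:
  fixes b :: "nat \<Rightarrow> complex"
  assumes bB: "\<And>n. norm (b n) \<le> B" and \<Omega>: "open \<Omega>" "{z. Re z \<ge> 0} \<subseteq> \<Omega>"
    and hol: "g holomorphic_on \<Omega>" and g0: "g 0 = 0"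
    and conv: "\<And>z. Re z > 0 \<Longrightarrow> (\<lambda>N. \<Sum>n=1..N. b n * of_nat n powr (-1 - z)) \<longlonglongrightarrow> g z"
    and R: "R > 0"
  shows "\<exists>C. \<forall>N\<ge>2. norm (\<Sum>n=1..N. b n / of_nat n) \<le> 2 * B / R + B / real N + C / ln (real N)"
proof -
  define S where "S N z = (\<Sum>n=1..N. b n * of_nat n powr (-1 - z))" for N :: nat and z :: complex
  have B0: "B \<ge> 0" using bB[of 0] norm_ge_zero[of "b 0"] by linarith
  have term_le: "norm (b n * of_nat n powr (-1 - z)) \<le> B * real n powr (-1 - Re z)" if "n > 0" for n z
    using bB[of n] by (simp add: norm_mult norm_of_nat_powr[OF that] mult_right_mono)
  have tail: "norm (g z - S N z) \<le> B * (real N powr (- Re z) / Re z)" if "Re z > 0" "N \<ge> 1" for z N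
  proof (rule tendsto_upperbound)
    show "(\<lambda>M. norm (S M z - S N z)) \<longlonglongrightarrow> norm (g z - S N z)"
      unfolding S_def by (intro tendsto_intros conv that)
    show "\<forall>\<^sub>F M in sequentially. norm (S M z - S N z) \<le> B * (real N powr (- Re z) / Re z)"
      using eventually_ge_at_top[of N]
    proof eventually_elim
      case (elim M)
      have "S M z = S N z + (\<Sum>n=Suc N..M. b n * of_nat n powr (-1 - z))"
        unfolding S_def using elim sum.ub_add_nat[of 1 N _ "M - N"] by simp
      then have "norm (S M z - S N z) = norm (\<Sum>n=Suc N..M. b n * of_nat n powr (-1 - z))" by simp
      also have "\<dots> \<le> (\<Sum>n=Suc N..M. B * real n powr (-1 - Re z))"
        by (rule sum_norm_le) (use term_le in auto)
      also have "\<dots> \<le> B * ((real N powr (- Re z) - real M powr (- Re z)) / Re z)"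
        unfolding sum_distrib_left[symmetric]
        by (intro mult_left_mono sum_powr_tail_le) (use elim that B0 in auto)
      also have "\<dots> \<le> B * (real N powr (- Re z) / Re z)"
        using that B0 by (intro mult_left_mono divide_right_mono) auto
      finally show ?case .
    qed
  qed simp
  have head: "norm (S N z) \<le> B * (real N powr (- Re z) / (- Re z) + real N powr (- Re z - 1))"
    if "Re z < 0" "N \<ge> 1" for z N
  proof -
    have "norm (S N z) \<le> (\<Sum>n=1..N. B * real n powr (-1 - Re z))"
      unfolding S_def by (rule sum_norm_le) (use term_le in auto)
    also have "\<dots> = B * (\<Sum>n=1..N. real n powr (- Re z - 1))"
      by (simp add: sum_distrib_left[symmetric] minus_diff_commute)
    also have "\<dots> \<le> B * (real N powr (- Re z) / (- Re z) + real N powr (- Re z - 1))"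
      by (intro mult_left_mono sum_powr_head_le) (use that B0 in auto)
    finally show ?thesis .
  qed
  have holS: "S N holomorphic_on A" for N A
    unfolding S_def by (intro holomorphic_intros) auto

  obtain \<epsilon> where \<epsilon>: "\<epsilon> > 0" "(\<Union>z\<in>closed_segment (-\<i> * R) (\<i> * R). ball z \<epsilon>) \<subseteq> \<Omega>"
  proof (rule compact_subset_open_imp_ball_epsilon_subset)
    show "closed_segment (-\<i> * R) (\<i> * R) \<subseteq> \<Omega>"
      using \<Omega>(2) by (auto simp: closed_segment_def)
  qed (use \<Omega> in auto)
  \<comment> \<open>A point of \<open>W\<close> to the left of the imaginary axis is closer than
    \<open>2 * \<delta> + \<delta> < \<epsilon>\<close> to the segment, so \<open>W\<close> lies in
    \<Omega>. Being convex, \<open>W\<close> admits Cauchy's theorem for every closed path in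
    it.\<close>
  define \<delta> where "\<delta> = \<epsilon> / 4"
  have \<delta>: "\<delta> > 0" using \<epsilon> by (simp add: \<delta>_def)
  define W where "W = {z. Re z > - 2 * \<delta>} \<inter> {z. Im z < R + \<delta>} \<inter> {z. Im z > - R - \<delta>}"
  have W: "open W" "convex W"
    unfolding W_def
    by (intro open_Int open_halfspace_Re_gt open_halfspace_Im_gt open_halfspace_Im_lt
         convex_Int convex_halfspace_Re_gt convex_halfspace_Im_gt convex_halfspace_Im_lt)+
  have "W \<subseteq> \<Omega>"
  proof
    fix z assume z: "z \<in> W"
    show "z \<in> \<Omega>"
    proof (cases "Re z \<ge> 0")
      case True
      then show ?thesis using \<Omega> by auto
    next
      case False
      define y where "y = max (-R) (min R (Im z))"
      have y: "-R \<le> y" "y \<le> R" "\<bar>Im z - y\<bar> < \<delta>"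
        using z R \<delta> by (auto simp: y_def W_def)
      have "\<i> * of_real y \<in> closed_segment (-\<i> * R) (\<i> * R)"
        unfolding closed_segment_def
        by (rule CollectI, rule exI[of _ "(y + R) / (2 * R)"])
           (use y R in \<open>auto simp: complex_eq_iff field_simps\<close>)
      moreover have "norm (\<i> * of_real y - z) \<le> \<bar>Re (\<i> * of_real y - z)\<bar> + \<bar>Im (\<i> * of_real y - z)\<bar>"
        by (rule cmod_le)
      then have "norm (\<i> * of_real y - z) < \<epsilon>"
        using y z False \<delta> abs_minus_commute[of y "Im z"] by (auto simp: W_def \<delta>_def)
      ultimately have "z \<in> (\<Union>w\<in>closed_segment (-\<i> * R) (\<i> * R). ball w \<epsilon>)"
        by (intro UN_I[of "\<i> * of_real y"]) (auto simp: dist_norm)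
      then show ?thesis using \<epsilon>(2) by blast
    qed
  qed
  have "0 \<in> W" using R \<delta> by (auto simp: W_def)
  \<comment> \<open>As \<open>g 0 = 0\<close>, the singularity of \<open>g z / z\<close> at 0 is
    removable. \<open>q\<close> is the extension, and \<open>F\<close> below extends
    \<open>g z * (1 / z + z / R^2)\<close>.\<close>
  define q where "q = (\<lambda>z. if z = 0 then deriv g 0 else (g z - g 0) / (z - 0))"
  have holq: "q holomorphic_on W"
    unfolding q_def by (rule pole_lemma_open) (use hol \<open>W \<subseteq> \<Omega>\<close> W in \<open>auto intro: holomorphic_on_subset\<close>)
  have gq: "g z = z * q z" for z using g0 by (simp add: q_def)

  define F where "F z = q z * (1 + z\<^sup>2 / of_real R ^ 2)" for z
  have holF: "F holomorphic_on W" unfolding F_def by (intro holomorphic_intros holq) (use R in auto)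
  \<comment> \<open>The way back from \<open>\<i> * R\<close> to \<open>-\<i> * R\<close> through
    \<open>-\<delta>\<close>. The path and the bound \<open>M\<close> are fixed before
    \<open>N\<close>, so the constant obtained from them does not depend on
    \<open>N\<close>.\<close>
  define T where "T = closed_segment (\<i> * R) (of_real (-\<delta>)) \<union> closed_segment (-\<i> * R) (of_real (-\<delta>))"
  have TW: "closed_segment (\<i> * R) (of_real (-\<delta>)) \<subseteq> W" "closed_segment (-\<i> * R) (of_real (-\<delta>)) \<subseteq> W"
    by (intro closed_segment_subset W; use R \<delta> in \<open>simp add: W_def\<close>)+
  have "compact (F ` T)"
    unfolding T_def
    by (intro compact_continuous_image compact_Un holomorphic_on_imp_continuous_on
         holomorphic_on_subset[OF holF]) (use TW in auto)
  then obtain M where M: "\<And>z. z \<in> T \<Longrightarrow> norm (F z) \<le> M"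
    by (meson bounded_iff compact_imp_bounded image_eqI)
  define C1 where "C1 = M * norm (of_real (-\<delta>) - \<i> * R) / \<delta> + M * norm (of_real (-\<delta>) - (-\<i> * R)) / \<delta>"
  show ?thesis
  proof (intro exI allI impI)
    fix N :: nat assume N: "N \<ge> 2"
    define L where "L = ln (real N)"
    have L: "L > 0" using N by (simp add: L_def)
    have expL: "exp (L * x) = real N powr x" for x
      using N by (simp add: L_def powr_def mult.commute)
    \<comment> \<open>\<open>exp (L * z)\<close> is \<open>N powr z\<close>. Away from 0,
      \<open>Q\<close> is \<open>g K\<close> and \<open>P\<close> is \<open>S K\<close> with the
      kernel \<open>K\<close> introduced above.\<close>
    define Q where "Q z = F z * exp (of_real L * z)" for z
    define P where "P z = (S N z * exp (of_real L * z) * (1 + z\<^sup>2 / of_real R ^ 2)) / (z - 0)" for z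
    have holQ: "Q holomorphic_on W" unfolding Q_def by (intro holomorphic_intros holF)
    \<comment> \<open>The full circle is parametrised from angle 0, so its right half comes as the
      two arcs \<open>?a1\<close> and \<open>?a3\<close>.\<close>
    let ?a1 = "part_circlepath 0 R 0 (pi/2)" and ?a2 = "part_circlepath 0 R (pi/2) (3*pi/2)"
      and ?a3 = "part_circlepath 0 R (3*pi/2) (2*pi)"
    let ?l1 = "linepath (\<i> * R) (of_real (-\<delta>))" and ?l2 = "linepath (of_real (-\<delta>)) (-\<i> * R)"
    have "3 * pi / 2 = pi + pi / 2" by simp
    then have "cos (3 * pi / 2) = 0" "sin (3 * pi / 2) = -1"
      by (simp_all only: cos_add sin_add) simp_all
    then have ends: "exp (\<i> * of_real (pi/2)) = \<i>" "exp (\<i> * of_real (3*pi/2)) = -\<i>"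
       "exp (\<i> * of_real (2*pi)) = 1"
      unfolding cis_conv_exp[symmetric] by (auto simp: complex_eq_iff)
    have path_ends: "pathstart ?a1 = of_real R" "pathfinish ?a1 = \<i> * R"
        "pathstart ?a3 = -\<i> * R" "pathfinish ?a3 = of_real R"
      by (simp_all only: pathstart_part_circlepath pathfinish_part_circlepath ends) simp_all
    have arc: "norm z = R" "z \<noteq> 0" if "z \<in> path_image ?a1 \<union> path_image ?a2 \<union> path_image ?a3" for z
      using that R by (auto dest!: in_path_image_part_circlepath)
    have Re_right: "Re z \<ge> 0" if z: "z \<in> path_image ?a1 \<union> path_image ?a3" for z
    proof -
      have im: "path_image ?a1 = (\<lambda>t. of_real R * cis t) ` {0..pi/2}"
        "path_image ?a3 = (\<lambda>t. of_real R * cis t) ` {3*pi/2..2*pi}"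
        by (simp_all add: path_image_part_circlepath' closed_segment_eq_real_ivl)
      obtain t where t: "z = of_real R * cis t" "0 \<le> t \<and> t \<le> pi/2 \<or> 3*pi/2 \<le> t \<and> t \<le> 2*pi"
        using z unfolding im image_iff Bex_def Un_iff atLeastAtMost_iff by blast
      have "cos t \<ge> 0"
      proof (cases "t \<le> pi/2")
        case True
        then show ?thesis using t by (intro cos_ge_zero) auto
      next
        case False
        then have "cos (t - 2*pi) \<ge> 0" using t by (intro cos_ge_zero) auto
        then show ?thesis by (simp add: cos_diff)
      qed
      then show ?thesis using t R by simp
    qed
    have Re_left: "Re z \<le> 0" if z: "z \<in> path_image ?a2" for z
    proof -
      have im: "path_image ?a2 = (\<lambda>t. of_real R * cis t) ` {pi/2..3*pi/2}"
        by (simp add: path_image_part_circlepath' closed_segment_eq_real_ivl)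
      obtain t where t: "z = of_real R * cis t" "pi/2 \<le> t" "t \<le> 3*pi/2"
        using z unfolding im image_iff Bex_def atLeastAtMost_iff by blast
      have "cos (t - pi) \<ge> 0" using t by (intro cos_ge_zero) auto
      then show ?thesis using t R by (simp add: cos_diff mult_nonneg_nonpos)
    qed
    have "z \<in> W" if "z \<in> path_image ?a1 \<union> path_image ?a3" for z
    proof -
      have "norm z = R" "Re z \<ge> 0" using that arc Re_right by auto
      then show ?thesis using abs_Im_le_cmod[of z] \<delta> by (auto simp: W_def)
    qed
    then have arcW: "path_image ?a1 \<subseteq> W" "path_image ?a3 \<subseteq> W" by auto

    have contP: "continuous_on (- {0}) P"
      unfolding P_def
      by (intro continuous_intros holomorphic_on_imp_continuous_on holS) (use R in auto)
    have intP: "P contour_integrable_on ?a1" "P contour_integrable_on ?a2" "P contour_integrable_on ?a3"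
      by (rule contour_integrable_continuous_part_circlepath, rule continuous_on_subset[OF contP],
          use arc in blast)+
    have intQ: "Q contour_integrable_on ?a1" "Q contour_integrable_on ?a3"
      by (intro contour_integrable_continuous_part_circlepath holomorphic_on_imp_continuous_on
           holomorphic_on_subset[OF holQ] arcW)+
    have intQl: "Q contour_integrable_on ?l1" "Q contour_integrable_on ?l2"
      using TW by (intro contour_integrable_continuous_linepath holomorphic_on_imp_continuous_on
           holomorphic_on_subset[OF holQ]; simp add: closed_segment_commute)+
    let ?I = "contour_integral"
    have "(\<lambda>z. S N z * exp (of_real L * z) * (1 + z\<^sup>2 / of_real R ^ 2)) holomorphic_on cball 0 R"
      by (intro holomorphic_intros holS) (use R in auto)
    then have "(P has_contour_integral (2 * of_real pi * \<i> * (S N 0 * exp (of_real L * 0) * (1 + 0\<^sup>2 / of_real R ^ 2))))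
        (circlepath 0 R)"
      unfolding P_def by (rule Cauchy_integral_circlepath_simple) (use R in simp)
    moreover have "(P has_contour_integral (?I ?a1 P + ?I ?a2 P + ?I ?a3 P)) (circlepath 0 R)"
    proof -
      let ?p = "\<lambda>t. P (0 + R * cis t) * R * \<i> * cis t"
      note int = intP[THEN has_contour_integral_integral]
      have i1: "(?p has_integral ?I ?a1 P) {0..pi/2}"
        by (rule iffD1[OF has_contour_integral_part_circlepath_iff int(1)]) simp
      have i2: "(?p has_integral ?I ?a2 P) {pi/2..3*pi/2}"
        by (rule iffD1[OF has_contour_integral_part_circlepath_iff int(2)]) simp
      have i3: "(?p has_integral ?I ?a3 P) {3*pi/2..2*pi}"
        by (rule iffD1[OF has_contour_integral_part_circlepath_iff int(3)]) simp
      have "(?p has_integral ?I ?a1 P + ?I ?a2 P) {0..3*pi/2}"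
        by (rule has_integral_combine[OF _ _ i1 i2]) auto
      then have "(?p has_integral ?I ?a1 P + ?I ?a2 P + ?I ?a3 P) {0..2*pi}"
        by (rule has_integral_combine[OF _ _ _ i3, rotated 2]) auto
      then show ?thesis unfolding circlepath_def
        by (rule iffD2[OF has_contour_integral_part_circlepath_iff, rotated]) simp
    qed
    ultimately have "2 * of_real pi * \<i> * (S N 0 * exp (of_real L * 0) * (1 + 0\<^sup>2 / of_real R ^ 2))
        = ?I ?a1 P + ?I ?a2 P + ?I ?a3 P"
      by (rule has_contour_integral_unique)
    then have eqP: "2 * of_real pi * \<i> * S N 0 = ?I ?a1 P + ?I ?a2 P + ?I ?a3 P"
      by simp
    have "(Q has_contour_integral 0) (?a3 +++ ?a1 +++ ?l1 +++ ?l2)"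
    proof (rule Cauchy_theorem_convex_simple[OF holQ])
      show "path_image (?a3 +++ ?a1 +++ ?l1 +++ ?l2) \<subseteq> W"
        using arcW TW by (intro subset_path_image_join) (auto simp: closed_segment_commute)
    qed (use W in \<open>auto simp: path_ends simp del: pathstart_part_circlepath pathfinish_part_circlepath
           intro!: valid_path_join\<close>)
    moreover have "(Q has_contour_integral (?I ?a3 Q + (?I ?a1 Q + (?I ?l1 Q + ?I ?l2 Q)))) (?a3 +++ ?a1 +++ ?l1 +++ ?l2)"
      by (intro has_contour_integral_join has_contour_integral_integral intQ intQl valid_path_join)
         (auto simp: path_ends simp del: pathstart_part_circlepath pathfinish_part_circlepath)
    ultimately have eqQ: "?I ?a3 Q + (?I ?a1 Q + (?I ?l1 Q + ?I ?l2 Q)) = 0"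
      using has_contour_integral_unique by blast
    have K: "exp (of_real L * z) * (1 + z\<^sup>2 / of_real R ^ 2) / z = exp (of_real L * z) * of_real (2 * Re z / R ^ 2)"
      if "norm z = R" for z
    proof -
      have "z \<noteq> 0" using that R by auto
      then have "(1 + z\<^sup>2 / of_real R ^ 2) / z = 1 / z + z / of_real R ^ 2"
        by (simp add: field_simps power2_eq_square)
      then show ?thesis using inverse_add_scaled_on_circle[OF that R] by (metis times_divide_eq_right)
    qed
    have right: "norm (P z - Q z) \<le> 2 * B / R\<^sup>2" if "z \<in> path_image ?a1 \<union> path_image ?a3" for z
    proof -
      have z: "norm z = R" "z \<noteq> 0" "Re z \<ge> 0" using arc Re_right that by auto
      have "P z = S N z * (exp (of_real L * z) * (1 + z\<^sup>2 / of_real R ^ 2) / z)"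
        by (simp add: P_def)
      moreover have "Q z = g z * (exp (of_real L * z) * (1 + z\<^sup>2 / of_real R ^ 2) / z)"
        using z(2) by (simp add: Q_def F_def gq)
      ultimately have "P z - Q z = (S N z - g z) * (exp (of_real L * z) * (1 + z\<^sup>2 / of_real R ^ 2) / z)"
        by (simp only: left_diff_distrib)
      also have "\<dots> = (S N z - g z) * (exp (of_real L * z) * of_real (2 * Re z / R ^ 2))"
        unfolding K[OF z(1)] ..
      finally have "norm (P z - Q z) = norm (g z - S N z) * (real N powr (Re z) * (2 * Re z / R ^ 2))"
        using z by (simp add: norm_mult norm_divide norm_power expL norm_minus_commute)
      also have "\<dots> \<le> 2 * B / R\<^sup>2"
      \<comment> \<open>On the imaginary axis \<open>tail\<close> says nothing, but there the kernel
        vanishes.\<close>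
      proof (cases "Re z = 0")
        case True
        then show ?thesis using B0 by simp
      next
        case False
        then have pos: "Re z > 0" using z by simp
        have "norm (g z - S N z) * (real N powr (Re z) * (2 * Re z / R ^ 2))
           \<le> B * (real N powr (- Re z) / Re z) * (real N powr (Re z) * (2 * Re z / R ^ 2))"
          using pos N by (intro mult_right_mono tail) auto
        also have "\<dots> = 2 * B / R\<^sup>2 * (real N powr (- Re z) * real N powr (Re z))"
          using pos by (simp add: field_simps)
        also have "real N powr (- Re z) * real N powr (Re z) = 1"
          using N by (simp add: powr_minus)
        finally show ?thesis by simp
      qed
      finally show ?thesis .
    qed
    have left: "norm (P z) \<le> 2 * B / R\<^sup>2 * (1 + R / real N)" if "z \<in> path_image ?a2" for z
    proof -
      have z: "norm z = R" "z \<noteq> 0" "Re z \<le> 0" using arc Re_left that by auto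
      have "P z = S N z * (exp (of_real L * z) * (1 + z\<^sup>2 / of_real R ^ 2) / z)"
        using z(2) by (simp add: P_def)
      also have "\<dots> = S N z * (exp (of_real L * z) * of_real (2 * Re z / R ^ 2))"
        unfolding K[OF z(1)] ..
      finally have "norm (P z) = norm (S N z) * (real N powr (Re z) * (2 * (- Re z) / R ^ 2))"
        using z by (simp add: norm_mult norm_divide norm_power expL)
      also have "\<dots> \<le> 2 * B / R\<^sup>2 * (1 + R / real N)"
      proof (cases "Re z = 0")
        case True
        then show ?thesis using B0 R by simp
      next
        case False
        then have neg: "Re z < 0" using z by simp
        have alg: "B * (a / x + a / n) * (d * (2 * x / R\<^sup>2)) = 2 * B / R\<^sup>2 * (a * d) * (1 + x / n)"
          if "x > 0" "n > 0" for a d x n :: real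
          using that R by (simp add: field_simps)
        have "norm (S N z) * (real N powr (Re z) * (2 * (- Re z) / R ^ 2))
           \<le> B * (real N powr (- Re z) / (- Re z) + real N powr (- Re z - 1)) *
              (real N powr (Re z) * (2 * (- Re z) / R ^ 2))"
          using neg N by (intro mult_right_mono head mult_nonneg_nonneg divide_nonneg_nonneg) auto
        also have "\<dots> = 2 * B / R\<^sup>2 * (real N powr (- Re z) * real N powr (Re z)) * (1 + (- Re z) / real N)"
          using alg[of "- Re z" "real N"] neg N by (simp add: powr_diff)
        also have "real N powr (- Re z) * real N powr (Re z) = 1"
          using N by (simp add: powr_minus)
        also have "2 * B / R\<^sup>2 * 1 * (1 + (- Re z) / real N) \<le> 2 * B / R\<^sup>2 * (1 + R / real N)"
          unfolding mult_1_right using B0 N z abs_Re_le_cmod[of z]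
          by (intro mult_left_mono add_left_mono divide_right_mono) auto
        finally show ?thesis by simp
      qed
      finally show ?thesis .
    qed
    have b1: "norm (?I ?a1 P - ?I ?a1 Q) \<le> pi * B / R"
    proof -
      have "norm (?I ?a1 (\<lambda>z. P z - Q z)) \<le> 2 * B / R\<^sup>2 * R * \<bar>pi/2 - 0\<bar>"
        by (rule contour_integral_bound_part_circlepath)
           (use intP intQ right R B0 in \<open>auto intro: contour_integrable_diff\<close>)
      then show ?thesis using R intP intQ by (simp add: contour_integral_diff power2_eq_square mult.commute)
    qed
    have b3: "norm (?I ?a3 P - ?I ?a3 Q) \<le> pi * B / R"
    proof -
      have "norm (?I ?a3 (\<lambda>z. P z - Q z)) \<le> 2 * B / R\<^sup>2 * R * \<bar>2*pi - 3*pi/2\<bar>"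
        by (rule contour_integral_bound_part_circlepath)
           (use intP intQ right R B0 in \<open>auto intro: contour_integrable_diff\<close>)
      then show ?thesis using R intP intQ by (simp add: contour_integral_diff power2_eq_square mult.commute)
    qed
    have b2: "norm (?I ?a2 P) \<le> 2 * pi * B / R + 2 * pi * B / real N"
    proof -
      have "norm (?I ?a2 P) \<le> 2 * B / R\<^sup>2 * (1 + R / real N) * R * \<bar>3*pi/2 - pi/2\<bar>"
        by (rule contour_integral_bound_part_circlepath)
           (use intP left R B0 in auto)
      also have "2 * B / R\<^sup>2 * (1 + R / real N) * R * \<bar>3*pi/2 - pi/2\<bar> = 2 * pi * B / R + 2 * pi * B / real N"
        using R N by (simp add: power2_eq_square field_simps)
      finally show ?thesis .
    qed
    have c1: "norm (?I ?l1 Q) \<le> M * norm (of_real (-\<delta>) - \<i> * R) / (\<delta> * L)"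
      unfolding Q_def using M TW \<delta> L
      by (intro contour_integral_linepath_exp_bound holomorphic_on_imp_continuous_on holomorphic_on_subset[OF holF])
         (auto simp: T_def)
    have "?I ?l2 Q = - ?I (linepath (-\<i> * R) (of_real (-\<delta>))) Q"
      by (metis contour_integral_reversepath reversepath_linepath valid_path_linepath minus_minus)
    moreover have "norm (?I (linepath (-\<i> * R) (of_real (-\<delta>))) Q) \<le> M * norm (of_real (-\<delta>) - (-\<i> * R)) / (\<delta> * L)"
      unfolding Q_def using M TW \<delta> L
      by (intro contour_integral_linepath_exp_bound holomorphic_on_imp_continuous_on holomorphic_on_subset[OF holF])
         (auto simp: T_def)
    ultimately have c2: "norm (?I ?l2 Q) \<le> M * norm (of_real (-\<delta>) - (-\<i> * R)) / (\<delta> * L)" by simp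
    have c: "norm (?I ?l1 Q) + norm (?I ?l2 Q) \<le> C1 / L"
      using c1 c2 unfolding C1_def by (simp add: add_divide_distrib)
    \<comment> \<open>By \<open>eqQ\<close> the integral of \<open>Q\<close> over the right half of
      the circle is traded for its negative over the two segments.\<close>
    have "2 * of_real pi * \<i> * S N 0 = (?I ?a1 P - ?I ?a1 Q) + ?I ?a2 P + (?I ?a3 P - ?I ?a3 Q) - ?I ?l1 Q - ?I ?l2 Q"
      unfolding eqP using eqQ by (simp add: add_eq_0_iff2)
    moreover have "norm (a + b + c - d - e) \<le> norm a + norm b + norm c + norm d + norm e"
      for a b c d e :: complex by norm
    ultimately have "norm (2 * of_real pi * \<i> * S N 0)
       \<le> norm (?I ?a1 P - ?I ?a1 Q) + norm (?I ?a2 P) + norm (?I ?a3 P - ?I ?a3 Q) + norm (?I ?l1 Q) + norm (?I ?l2 Q)"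
      by metis
    also have "\<dots> \<le> pi * B / R + (2 * pi * B / R + 2 * pi * B / real N) + pi * B / R + C1 / L"
      using b1 b2 b3 c by linarith
    also have "\<dots> = 2 * pi * (2 * B / R + B / real N + (C1 / (2 * pi)) / L)"
      by (simp add: field_simps)
    finally have "norm (S N 0) \<le> 2 * B / R + B / real N + (C1 / (2 * pi)) / L"
      by (simp add: norm_mult)
    moreover have "S N 0 = (\<Sum>n=1..N. b n / of_nat n)"
      unfolding S_def by (intro sum.cong) (auto simp: powr_minus divide_inverse)
    ultimately show "norm (\<Sum>n=1..N. b n / of_nat n) \<le> 2 * B / R + B / real N + (C1 / (2 * pi)) / ln (real N)"
      by (simp add: L_def)
  qed
qed


text \<open>Once the value at 0 is normalised to 0, the preceding bound shows that the limes
  superior of the partial sums is at most a constant over \<open>R\<close>, for every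
  \<open>R\<close>.\<close>

lemma newman_tauberian:
  fixes b :: "nat \<Rightarrow> complex"
  assumes bB: "\<And>n. norm (b n) \<le> B" and \<Omega>: "open \<Omega>" "{z. Re z \<ge> 0} \<subseteq> \<Omega>"
    and hol: "g holomorphic_on \<Omega>"
    and conv: "\<And>z. Re z > 0 \<Longrightarrow> (\<lambda>N. \<Sum>n=1..N. b n * of_nat n powr (-1 - z)) \<longlonglongrightarrow> g z"
  shows "(\<lambda>N. \<Sum>n=1..N. b n / of_nat n) \<longlonglongrightarrow> g 0"
proof -
  \<comment> \<open>Only the constant term of the series changes, so that the sum vanishes at \<open>0\<close>.\<close>
  define c where "c n = (if n = 1 then b 1 - g 0 else b n)" for n
  define B' where "B' = B + norm (g 0)"
  have shift: "(\<Sum>n=1..N. c n * w n) = (\<Sum>n=1..N. b n * w n) - g 0" if "w 1 = 1" "N \<ge> 1"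
    for w :: "nat \<Rightarrow> complex" and N
  proof -
    have "{1..N} = insert 1 {2..N}" using that by auto
    moreover have "(\<Sum>n=2..N. c n * w n) = (\<Sum>n=2..N. b n * w n)"
      by (intro sum.cong) (auto simp: c_def)
    ultimately show ?thesis using that by (simp add: c_def)
  qed
  have c: "norm (c n) \<le> B'" for n
    using bB[of n] norm_triangle_ineq4[of "b 1" "g 0"] by (auto simp: c_def B'_def intro: add_increasing2)
  then have "B' \<ge> 0" by (meson norm_ge_zero order_trans)
  have conv': "(\<lambda>N. \<Sum>n=1..N. c n * of_nat n powr (-1 - z)) \<longlonglongrightarrow> g z - g 0" if "Re z > 0" for z
  proof (rule Lim_transform_eventually)
    show "(\<lambda>N. (\<Sum>n=1..N. b n * of_nat n powr (-1 - z)) - g 0) \<longlonglongrightarrow> g z - g 0"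
      by (intro tendsto_intros conv that)
    show "\<forall>\<^sub>F N in sequentially. (\<Sum>n=1..N. b n * of_nat n powr (-1 - z)) - g 0 = (\<Sum>n=1..N. c n * of_nat n powr (-1 - z))"
      using eventually_ge_at_top[of 1] by eventually_elim (subst shift, auto)
  qed
  have "(\<lambda>N. \<Sum>n=1..N. c n / of_nat n) \<longlonglongrightarrow> 0"
  proof (rule tendstoI)
    fix e :: real assume e: "e > 0"
    \<comment> \<open>Any \<open>R\<close> above \<open>4 * B' / e\<close> makes
      \<open>2 * B' / R\<close> smaller than \<open>e / 2\<close>; adding 1 also keeps
      \<open>R\<close> positive when \<open>B' = 0\<close>.\<close>
    define R where "R = 4 * B' / e + 1"
    have R: "R > 0" using e \<open>B' \<ge> 0\<close> by (simp add: R_def add_nonneg_pos)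
    have Re: "2 * B' / R < e / 2"
      using e R \<open>B' \<ge> 0\<close> by (simp add: R_def field_simps)
    obtain C where C: "\<And>N. N \<ge> 2 \<Longrightarrow> norm (\<Sum>n=1..N. c n / of_nat n) \<le> 2 * B' / R + B' / real N + C / ln (real N)"
      using newman_key_bound[OF c \<Omega> holomorphic_on_diff[OF hol holomorphic_on_const] _ conv' R] by auto
    have "(\<lambda>N. B' / real N + C / ln (real N)) \<longlonglongrightarrow> 0"
      by real_asymp
    then have "\<forall>\<^sub>F N in sequentially. B' / real N + C / ln (real N) < e / 2"
      using e by (intro order_tendstoD) auto
    then show "\<forall>\<^sub>F N in sequentially. dist (\<Sum>n=1..N. c n / of_nat n) 0 < e"
      using eventually_ge_at_top[of 2]
    proof eventually_elim
      case (elim N)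
      then have "norm (\<Sum>n=1..N. c n / of_nat n) < e" using C[of N] Re by linarith
      then show ?case by simp
    qed
  qed
  then have "(\<lambda>N. (\<Sum>n=1..N. c n / of_nat n) + g 0) \<longlonglongrightarrow> 0 + g 0"
    by (intro tendsto_intros)
  moreover have "\<forall>\<^sub>F N in sequentially. (\<Sum>n=1..N. c n / of_nat n) + g 0 = (\<Sum>n=1..N. b n / of_nat n)"
    using eventually_ge_at_top[of 1]
    by eventually_elim (use shift[of "\<lambda>n. inverse (of_nat n)"] in \<open>simp add: divide_inverse\<close>)
  ultimately show ?thesis by (simp add: Lim_transform_eventually)
qed

section \<open>Dirichlet series\<close>

text \<open>The double series converges absolutely, so it may be summed along the fibres of the
  product: the pair \<open>(a, b)\<close> is recorded as \<open>(a * b, a)\<close>.\<close>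

lemma dirichlet_product_sums:
  fixes f g :: "nat \<Rightarrow> complex"
  assumes "summable (\<lambda>n. norm (f n))" "summable (\<lambda>n. norm (g n))" and "f 0 = 0" "g 0 = 0"
  shows "(\<lambda>n. \<Sum>d | d dvd n. f d * g (n div d)) sums (suminf f * suminf g)"
proof -
  \<comment> \<open>Index 0 is set aside because every number divides 0. The sum over that infinite
    set of divisors is 0 by default, so the term \<open>n = 0\<close> can be put back at the
    end.\<close>
  define P where "P = {1::nat..}"
  have has_sum_P: "(h has_sum s) P \<longleftrightarrow> (h has_sum s) UNIV" if "h 0 = 0" for h :: "nat \<Rightarrow> complex" and s
    by (rule has_sum_cong_neutral) (use that in \<open>auto simp: P_def not_le\<close>)
  have fs: "(f has_sum suminf f) P" and gs: "(g has_sum suminf g) P"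
    using assms by (auto simp: has_sum_P intro!: norm_summable_imp_has_sum summable_sums summable_norm_cancel)
  have abs: "(\<lambda>n. norm (h n)) summable_on P" if "summable (\<lambda>n. norm (h n))" for h :: "nat \<Rightarrow> complex"
    by (rule summable_on_subset_banach[of _ UNIV]) (use that in \<open>auto simp: summable_on_UNIV_nonneg_real_iff\<close>)
  have "(\<lambda>x. norm (case x of (a,b) \<Rightarrow> f a * g b)) summable_on P \<times> P"
  proof (subst Infinite_Sum.abs_summable_on_Sigma_iff, intro conjI ballI)
    show "(\<lambda>b. norm (case (a, b) of (a, b) \<Rightarrow> f a * g b)) summable_on P" for a
      using abs[OF assms(2)] by (simp add: norm_mult summable_on_cmult_right)
    have "(\<lambda>a. norm (f a) * (\<Sum>\<^sub>\<infinity>b\<in>P. norm (g b))) summable_on P"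
      by (intro summable_on_cmult_left abs assms)
    then show "(\<lambda>a. norm (\<Sum>\<^sub>\<infinity>b\<in>P. norm (case (a, b) of (a, b) \<Rightarrow> f a * g b))) summable_on P"
      by (simp add: norm_mult infsum_cmult_right' abs_mult infsum_nonneg)
  qed
  then have summ: "(\<lambda>(a,b). f a * g b) summable_on P \<times> P"
    by (rule abs_summable_summable)
  have "((\<lambda>(a,b). f a * g b) has_sum (suminf f * suminf g)) (P \<times> P)"
    by (rule has_sum_SigmaI[OF _ _ summ]) (auto intro!: has_sum_cmult_right has_sum_cmult_left fs gs)
  also have "?this \<longleftrightarrow> ((\<lambda>x. (\<lambda>(a,b). f a * g b) ((\<lambda>(n,d). (d, n div d)) x)) has_sum (suminf f * suminf g))
      (SIGMA n:P. {d. d dvd n})"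
  proof (rule has_sum_reindex_bij_betw[symmetric], rule bij_betwI[where g = "\<lambda>(a,b). (a * b, a)"])
    show "(\<lambda>(n,d). (d, n div d)) \<in> (SIGMA n:P. {d. d dvd n}) \<rightarrow> P \<times> P"
      by (auto simp: P_def Suc_le_eq dvd_imp_le div_greater_zero_iff intro: dvd_pos_nat)
    show "(\<lambda>(a,b). (a * b, a)) \<in> P \<times> P \<rightarrow> (SIGMA n:P. {d. d dvd n})"
      by (auto simp: P_def Suc_le_eq)
  qed (auto simp: P_def)
  finally have "((\<lambda>(n,d). f d * g (n div d)) has_sum (suminf f * suminf g)) (SIGMA n:P. {d. d dvd n})"
    by (simp add: case_prod_unfold)
  then have "((\<lambda>n. \<Sum>d | d dvd n. f d * g (n div d)) has_sum (suminf f * suminf g)) P"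
    by (rule has_sum_SigmaD) (auto simp: P_def intro!: has_sum_finite)
  then show ?thesis by (subst (asm) has_sum_P) (auto intro: has_sum_imp_sums)
qed

text \<open>The Weierstrass test, applied locally. The majorant may depend on \<sigma> and on the
  radius \<open>r\<close> because the terms of \<open>zeta_reg\<close> grow with the modulus of
  \<open>s\<close>.\<close>

lemma halfplane_series:
  fixes f :: "nat \<Rightarrow> complex \<Rightarrow> complex"
  assumes hol: "\<And>n. f n holomorphic_on {s. Re s > c}"
    and bnd: "\<And>\<sigma> r. \<sigma> > c \<Longrightarrow> \<exists>M. summable M \<and> (\<forall>n s. Re s \<ge> \<sigma> \<longrightarrow> norm s \<le> r \<longrightarrow> norm (f n s) \<le> M n)"
  shows halfplane_series_holomorphic: "(\<lambda>s. \<Sum>n. f n s) holomorphic_on {s. Re s > c}"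
    and halfplane_series_summable: "Re s > c \<Longrightarrow> summable (\<lambda>n. norm (f n s))"
    and halfplane_series_deriv: "Re s > c \<Longrightarrow> (\<lambda>n. deriv (f n) s) sums deriv (\<lambda>s. \<Sum>n. f n s) s"
proof -
  let ?S = "{s. Re s > c}"
  have "open ?S" by (rule open_halfspace_Re_gt)
  have "\<exists>g g'. \<forall>x \<in> ?S. ((\<lambda>n. f n x) sums g x) \<and> ((\<lambda>n. deriv (f n) x) sums g' x) \<and> (g has_field_derivative g' x) (at x)"
  proof (rule series_and_derivative_comparison_complex[OF \<open>open ?S\<close>])
    show "(f n has_field_derivative deriv (f n) x) (at x)" if "x \<in> ?S" for n x
      using hol \<open>open ?S\<close> that by (rule holomorphic_derivI)
    fix x assume x: "x \<in> ?S"
    \<comment> \<open>Half the distance to the boundary line, so that the ball of radius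
      \<open>d\<close> stays in \<open>Re s >= c + d\<close>.\<close>
    define d where "d = (Re x - c) / 2"
    have "c + d > c" using x by (simp add: d_def)
    then obtain M where M: "summable M" "\<And>n s. Re s \<ge> c + d \<Longrightarrow> norm s \<le> norm x + d \<Longrightarrow> norm (f n s) \<le> M n"
      using bnd by meson
    have near: "Re y \<ge> c + d" "norm y \<le> norm x + d" if "y \<in> ball x d" for y
    proof -
      have "norm (x - y) < d" using that by (simp add: dist_norm)
      then show "Re y \<ge> c + d" using abs_Re_le_cmod[of "x - y"] by (simp add: d_def field_simps)
      show "norm y \<le> norm x + d" using \<open>norm (x - y) < d\<close> norm_triangle_ineq2[of y x] by (simp add: norm_minus_commute)
    qed
    have "d > 0" using x by (simp add: d_def)
    then have M0: "M n \<ge> 0" for n using M(2)[OF near[of x]] norm_ge_zero[of "f n x"] by (meson centre_in_ball order_trans)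
    show "\<exists>d h. 0 < d \<and> summable h \<and> range h \<subseteq> \<real>\<^sub>\<ge>\<^sub>0 \<and> (\<forall>\<^sub>F n in sequentially. \<forall>y\<in>ball x d \<inter> ?S. cmod (f n y) \<le> cmod (h n))"
      by (rule exI[of _ d], rule exI[of _ "\<lambda>n. complex_of_real (M n)"])
         (use \<open>d > 0\<close> M M0 near in \<open>auto simp: summable_of_real\<close>)
  qed
  then obtain g g' where g: "\<And>x. x \<in> ?S \<Longrightarrow> (\<lambda>n. f n x) sums g x" "\<And>x. x \<in> ?S \<Longrightarrow> (\<lambda>n. deriv (f n) x) sums g' x"
      "\<And>x. x \<in> ?S \<Longrightarrow> (g has_field_derivative g' x) (at x)" by blast
  have eq: "(\<Sum>n. f n x) = g x" if "x \<in> ?S" for x using g(1)[OF that] by (rule sums_unique[symmetric])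
  have der: "((\<lambda>s. \<Sum>n. f n s) has_field_derivative g' x) (at x)" if "x \<in> ?S" for x
    by (rule has_field_derivative_transform_within_open[OF g(3)[OF that] \<open>open ?S\<close> that]) (simp add: eq)
  then show "(\<lambda>s. \<Sum>n. f n s) holomorphic_on ?S"
    using \<open>open ?S\<close> by (auto simp: holomorphic_on_open)
  show "Re s > c \<Longrightarrow> (\<lambda>n. deriv (f n) s) sums deriv (\<lambda>s. \<Sum>n. f n s) s"
    using g(2)[of s] DERIV_imp_deriv[OF der, of s] by simp
  assume s: "Re s > c"
  then obtain M where "summable M" "\<And>n. norm (f n s) \<le> M n" using bnd[of "Re s" "norm s"] by auto
  then show "summable (\<lambda>n. norm (f n s))"
    by (intro summable_comparison_test[of "\<lambda>n. norm (f n s)" M]) auto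
qed

text \<open>The series run over all \<open>n \<ge> 0\<close>; the junk value \<open>0 powr w = 0\<close> makes the first term vanish.\<close>

definition zeta_series :: "complex \<Rightarrow> complex" where
  "zeta_series s = (\<Sum>n. of_nat n powr (-s))"

definition mangoldt_series :: "complex \<Rightarrow> complex" where
  "mangoldt_series s = (\<Sum>n. mangoldt n * of_nat n powr (-s))"

lemma of_nat_powr_holomorphic [holomorphic_intros]:
  "f holomorphic_on A \<Longrightarrow> (\<lambda>s. of_nat n powr f s :: complex) holomorphic_on A"
  by (cases "n = 0") (auto intro!: holomorphic_intros)

lemma norm_of_nat_powr_le:
  assumes "Re w \<le> x" shows "norm (of_nat n powr w :: complex) \<le> real n powr x"
proof (cases "n = 0")
  case False
  then show ?thesis using assms by (simp add: norm_of_nat_powr powr_mono)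
qed auto

text \<open>The logarithm costs a power \<open>n powr a\<close>; taking \<open>a\<close> as half of
  \<open>\<sigma> - 1\<close> leaves an exponent below -1.\<close>

lemma summable_ln_powr:
  assumes "\<sigma> > 1" shows "summable (\<lambda>n. ln (real n) * real n powr (-\<sigma>))"
proof (rule summable_comparison_test)
  define a where "a = (\<sigma> - 1) / 2"
  have a: "a > 0" "a - \<sigma> < -1" using assms by (auto simp: a_def field_simps)
  show "summable (\<lambda>n. 1 / a * real n powr (a - \<sigma>))"
    using a by (intro summable_mult) (simp add: summable_real_powr_iff)
  show "\<exists>N. \<forall>n\<ge>N. norm (ln (real n) * real n powr (-\<sigma>)) \<le> 1 / a * real n powr (a - \<sigma>)"
  proof (intro exI allI impI)
    fix n :: nat assume n: "n \<ge> 1"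
    have "norm (ln (real n) * real n powr (-\<sigma>)) = ln (real n) * real n powr (-\<sigma>)"
      using n by simp
    also have "\<dots> \<le> real n powr a / a * real n powr (-\<sigma>)"
      using n a by (intro mult_right_mono ln_powr_bound) auto
    also have "\<dots> = 1 / a * real n powr (a - \<sigma>)"
      by (simp add: powr_add[symmetric])
    finally show "norm (ln (real n) * real n powr (-\<sigma>)) \<le> 1 / a * real n powr (a - \<sigma>)" .
  qed
qed

lemma mangoldt_le_ln: "mangoldt n \<le> ln (real n)"
  using mangoldt_le[of n] by (cases "n = 0") auto

lemma zeta_series_bound:
  "\<sigma> > 1 \<Longrightarrow> \<exists>M. summable M \<and> (\<forall>n s. Re s \<ge> \<sigma> \<longrightarrow> norm s \<le> r \<longrightarrow> norm (of_nat n powr (-s) :: complex) \<le> M n)"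
  by (intro exI[of _ "\<lambda>n. real n powr (-\<sigma>)"]) (auto simp: summable_real_powr_iff intro: norm_of_nat_powr_le)

lemma mangoldt_series_bound:
  "\<sigma> > 1 \<Longrightarrow> \<exists>M. summable M \<and> (\<forall>n s. Re s \<ge> \<sigma> \<longrightarrow> norm s \<le> r \<longrightarrow> norm (mangoldt n * of_nat n powr (-s) :: complex) \<le> M n)"
  by (intro exI[of _ "\<lambda>n. ln (real n) * real n powr (-\<sigma>)"])
     (auto simp: summable_ln_powr norm_mult mangoldt_nonneg mangoldt_le_ln
        intro!: norm_of_nat_powr_le mult_mono order_trans[OF mangoldt_nonneg mangoldt_le_ln])

lemma mangoldt_series_holomorphic: "mangoldt_series holomorphic_on {s. Re s > 1}"
  unfolding mangoldt_series_def[abs_def]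
  by (rule halfplane_series_holomorphic[OF _ mangoldt_series_bound]) (auto intro!: holomorphic_intros)

lemma mangoldt_series_sums:
  assumes "Re s > 1"
  shows "(\<lambda>n. mangoldt n * of_nat n powr (-s)) sums mangoldt_series s"
  unfolding mangoldt_series_def
  by (intro summable_sums summable_norm_cancel[OF halfplane_series_summable[OF _ mangoldt_series_bound assms]])
     (auto intro!: holomorphic_intros)

lemma zeta_series_sums:
  assumes "Re s > 1"
  shows "(\<lambda>n. of_nat n powr (-s)) sums zeta_series s"
  unfolding zeta_series_def
  by (intro summable_sums summable_norm_cancel[OF halfplane_series_summable[OF _ zeta_series_bound assms]])
     (auto intro!: holomorphic_intros)

lemma zeta_series_holomorphic: "zeta_series holomorphic_on {s. Re s > 1}"
  unfolding zeta_series_def[abs_def]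
  by (rule halfplane_series_holomorphic[OF _ zeta_series_bound]) (auto intro!: holomorphic_intros)

text \<open>Termwise differentiation produces the coefficients \<open>- ln n\<close>, and
  \<open>ln n\<close> is the divisor sum of \<open>mangoldt\<close>, so the right-hand side is a
  Dirichlet product. The form without a quotient avoids dividing by \<open>zeta_series\<close>, not
  yet known to be nonzero.\<close>

lemma deriv_zeta_series:
  assumes "Re s > 1"
  shows "deriv zeta_series s = - mangoldt_series s * zeta_series s"
proof -
  have "(\<lambda>n. deriv (\<lambda>s. of_nat n powr (-s)) s) sums deriv zeta_series s"
    unfolding zeta_series_def[abs_def]
    by (rule halfplane_series_deriv[OF _ zeta_series_bound assms]) (auto intro!: holomorphic_intros)
  moreover have "deriv (\<lambda>s. of_nat n powr (-s)) s = - (of_real (ln (real n)) * of_nat n powr (-s))" for n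
  proof (cases "n = 0")
    case False
    then show ?thesis
      using DERIV_chain2[OF has_field_derivative_powr_right[of "of_nat n" "-s"] DERIV_minus[OF DERIV_ident]]
      by (intro DERIV_imp_deriv) (simp add: Ln_of_nat)
  qed auto
  moreover have "(\<lambda>n. \<Sum>d | d dvd n. mangoldt d * of_nat d powr (-s) * of_nat (n div d) powr (-s)) sums (mangoldt_series s * zeta_series s)"
    unfolding mangoldt_series_def zeta_series_def
    by (rule dirichlet_product_sums)
       (auto intro!: halfplane_series_summable[OF _ mangoldt_series_bound assms]
           halfplane_series_summable[OF _ zeta_series_bound assms] holomorphic_intros)
  moreover have "(\<Sum>d | d dvd n. mangoldt d * of_nat d powr (-s) * of_nat (n div d) powr (-s)) = of_real (ln (real n)) * of_nat n powr (-s)" for n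
  proof (cases "n = 0")
    case False
    have "(\<Sum>d | d dvd n. mangoldt d * of_nat d powr (-s) * of_nat (n div d) powr (-s)) = (\<Sum>d | d dvd n. mangoldt d * of_nat n powr (-s))"
    proof (intro sum.cong refl)
      fix d assume "d \<in> {d. d dvd n}"
      then have "n = d * (n div d)" by simp
      then have "of_nat n powr (-s) = of_real (real d * real (n div d)) powr (-s)"
        by (metis of_nat_mult of_real_of_nat_eq)
      also have "\<dots> = of_nat d powr (-s) * of_nat (n div d) powr (-s)"
        by (simp add: powr_times_real)
      finally show "mangoldt d * of_nat d powr (-s) * of_nat (n div d) powr (-s) = mangoldt d * of_nat n powr (-s)"
        by simp
    qed
    then show ?thesis using mangoldt_sum[OF False, where ?'a = complex] by (simp add: sum_distrib_right[symmetric])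
  qed auto
  ultimately have "(\<lambda>n. - (of_real (ln (real n)) * of_nat n powr (-s))) sums deriv zeta_series s"
    "(\<lambda>n. of_real (ln (real n)) * of_nat n powr (-s)) sums (mangoldt_series s * zeta_series s)" by simp_all
  from sums_unique2[OF this(1) sums_minus[OF this(2)]] show ?thesis by simp
qed

section \<open>Non-vanishing of the zeta function\<close>

text \<open>
  For \<open>n > 0\<close> this is \<open>(1 - s)\<close> times the integral of \<open>x\<^bsup>-s\<^esup> - n\<^bsup>-s\<^esup>\<close> over \<open>[n, n + 1]\<close>, and for
  \<open>n = 0\<close> it is \<open>1\<close>; so the sum over all \<open>n\<close> is \<open>(s - 1) \<zeta>(s)\<close> for \<open>Re s > 1\<close>, but converges for
  \<open>Re s > 0\<close>.
\<close>

definition powr_remainder :: "nat \<Rightarrow> complex \<Rightarrow> complex" where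
  "powr_remainder n s = of_nat (Suc n) powr (1 - s) - of_nat n powr (1 - s) - (1 - s) * of_nat n powr (-s)"

lemma powr_remainder_holomorphic [holomorphic_intros]:
  "f holomorphic_on A \<Longrightarrow> (\<lambda>s. powr_remainder n (f s)) holomorphic_on A"
  unfolding powr_remainder_def by (intro holomorphic_intros)

text \<open>\<open>powr_remainder n s\<close> is the error of the first-order Taylor expansion of
  \<open>x powr (1 - s)\<close> from \<open>n\<close> to \<open>n + 1\<close>. The second derivative
  has modulus \<open>norm (1 - s) * norm s * x powr (- Re s - 1)\<close>, which for
  \<open>Re s >= -1\<close> is largest at \<open>x = n\<close>.\<close>

lemma norm_powr_remainder_le:
  assumes n: "n > 0" and s: "Re s \<ge> -1"
  shows "norm (powr_remainder n s) \<le> norm (1 - s) * norm s * real n powr (- Re s - 1)"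
proof -
  \<comment> \<open>\<open>f 0\<close>, \<open>f 1\<close>, \<open>f 2\<close> are the function and
    its first two derivatives.\<close>
  define f where "f i x = (if i = 0 then x powr (1 - s) else if i = 1 then (1 - s) * x powr (-s)
      else (1 - s) * (-s) * x powr (-s - 1))" for i :: nat and x :: complex
  let ?S = "closed_segment (of_nat n) (of_nat (Suc n)) :: complex set"
  have S: "x \<in> \<real> \<and> Re x \<ge> real n" if "x \<in> ?S" for x
    using that by (auto simp: closed_segment_def algebra_simps complex_is_Real_iff)
  have neg: "x \<notin> \<real>\<^sub>\<le>\<^sub>0" if "x \<in> ?S" for x
    using S[OF that] n by (auto elim!: nonpos_Reals_cases)
  have "norm (f 0 (of_nat (Suc n)) - (\<Sum>i\<le>1. f i (of_nat n) * (of_nat (Suc n) - of_nat n) ^ i / fact i))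
     \<le> (norm (1 - s) * norm s * real n powr (- Re s - 1)) * norm (of_nat (Suc n) - of_nat n :: complex) ^ Suc 1 / fact 1"
  proof (rule complex_Taylor)
    fix i x assume x: "x \<in> ?S" and "i \<le> (1::nat)"
    then consider "i = 0" | "i = 1" by linarith
    then show "(f i has_field_derivative f (Suc i) x) (at x within ?S)"
    proof cases
      case 1
      then show ?thesis unfolding f_def
        by (auto intro!: derivative_eq_intros simp: neg[OF x])
    next
      case 2
      then show ?thesis unfolding f_def
        by (auto intro!: derivative_eq_intros simp: neg[OF x])
    qed
  next
    fix x assume x: "x \<in> ?S"
    then have xr: "Re x \<ge> real n" "x = of_real (Re x)" using S by (auto simp: complex_is_Real_iff complex_eq_iff)
    have "norm (x powr (-s - 1)) = Re x powr (- Re s - 1)"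
      using S[OF x] n by (subst norm_powr_real_powr) auto
    also have "\<dots> \<le> real n powr (- Re s - 1)"
      using xr n s by (intro powr_mono2') auto
    finally show "norm (f (Suc 1) x) \<le> norm (1 - s) * norm s * real n powr (- Re s - 1)"
      by (auto simp: f_def norm_mult intro!: mult_left_mono)
  qed auto
  then show ?thesis by (simp add: f_def powr_remainder_def diff_diff_eq)
qed

lemma powr_remainder_0: "powr_remainder 0 s = 1"
  by (simp add: powr_remainder_def)

lemma powr_remainder_series_bound:
  assumes "\<sigma> > (0::real)"
  shows "\<exists>M. summable M \<and> (\<forall>n s. Re s \<ge> \<sigma> \<longrightarrow> norm s \<le> r \<longrightarrow> norm (powr_remainder n s) \<le> M n)"
proof (intro exI conjI allI impI)
  show "summable (\<lambda>n. (if n = 0 then 1 else 0) + (1 + r) * r * real n powr (-\<sigma> - 1))"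
    using assms by (intro summable_add summable_mult) (auto simp: summable_real_powr_iff)
  fix n s assume s: "Re s \<ge> \<sigma>" "norm s \<le> r"
  show "norm (powr_remainder n s) \<le> (if n = 0 then 1 else 0) + (1 + r) * r * real n powr (-\<sigma> - 1)"
  proof (cases "n = 0")
    case False
    have "norm (powr_remainder n s) \<le> norm (1 - s) * norm s * real n powr (- Re s - 1)"
      using False s assms by (intro norm_powr_remainder_le) auto
    also have "\<dots> \<le> (1 + r) * r * real n powr (-\<sigma> - 1)"
      using s False assms norm_triangle_ineq4[of 1 s] order_trans[OF norm_ge_zero s(2)]
      by (intro mult_mono powr_mono) auto
    finally show ?thesis using False by simp
  qed (simp add: powr_remainder_0)
qed

definition zeta_reg :: "complex \<Rightarrow> complex" where
  "zeta_reg s = (\<Sum>n. powr_remainder n s)"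

lemma zeta_reg_holomorphic: "zeta_reg holomorphic_on {s. Re s > 0}"
  unfolding zeta_reg_def[abs_def]
  by (rule halfplane_series_holomorphic[OF _ powr_remainder_series_bound]) (auto intro!: holomorphic_intros)

text \<open>Since \<open>0 powr 0 = 0\<close>, the term \<open>n = 0\<close> is 1 while all others
  vanish. This value is the residue of zeta at 1, and it shows that \<open>zeta_reg\<close> is not
  identically zero.\<close>

lemma zeta_reg_1: "zeta_reg 1 = 1"
proof -
  have "powr_remainder n 1 = (if n = 0 then 1 else 0)" for n
    by (simp add: powr_remainder_def del: of_nat_Suc)
  then show ?thesis using suminf_finite[of "{0}" "\<lambda>n. powr_remainder n 1"] by (simp add: zeta_reg_def)
qed

lemma of_nat_powr_tendsto_0:
  assumes "Re w < 0"
  shows "(\<lambda>n. of_nat n powr w :: complex) \<longlonglongrightarrow> 0"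
proof (rule tendsto_0_le[where K = 1])
  show "(\<lambda>n. real n powr Re w) \<longlonglongrightarrow> 0"
    using assms by real_asymp
  show "\<forall>\<^sub>F n in sequentially. norm (of_nat n powr w :: complex) \<le> norm (real n powr Re w) * 1"
    by (auto intro: always_eventually norm_of_nat_powr_le)
qed

text \<open>The first two parts of \<open>powr_remainder\<close> telescope to 0: the powers tend to
  0, and the initial one is 0 because the base is 0.\<close>

lemma zeta_reg_eq:
  assumes "Re s > 1"
  shows "zeta_reg s = (s - 1) * zeta_series s"
proof -
  have "(\<lambda>n. of_nat (Suc n) powr (1 - s) - of_nat n powr (1 - s)) sums (0 - of_nat 0 powr (1 - s) :: complex)"
    by (rule telescope_sums, rule of_nat_powr_tendsto_0) (use assms in auto)
  then have "(\<lambda>n. powr_remainder n s) sums (0 - of_nat 0 powr (1 - s) - (1 - s) * zeta_series s)"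
    unfolding powr_remainder_def by (rule sums_diff[OF _ sums_mult[OF zeta_series_sums[OF assms]]])
  then show ?thesis by (simp add: zeta_reg_def sums_iff algebra_simps)
qed

text \<open>Stated as a product because the non-vanishing of \<open>zeta_reg\<close> for
  \<open>Re s > 1\<close> will be deduced from it.\<close>

lemma deriv_zeta_reg:
  assumes "Re s > 1"
  shows "deriv zeta_reg s = zeta_reg s * (1 / (s - 1) - mangoldt_series s)"
proof -
  have S: "open {s. Re s > 1}" by (rule open_halfspace_Re_gt)
  have "(zeta_series has_field_derivative (- mangoldt_series s * zeta_series s)) (at s)"
    using holomorphic_derivI[OF zeta_series_holomorphic S, of s] deriv_zeta_series[OF assms] assms by simp
  then have "((\<lambda>s. (s - 1) * zeta_series s) has_field_derivative (zeta_series s + (s - 1) * (- mangoldt_series s * zeta_series s))) (at s)"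
    by (auto intro!: derivative_eq_intros)
  then have "(zeta_reg has_field_derivative (zeta_series s + (s - 1) * (- mangoldt_series s * zeta_series s))) (at s)"
    by (rule has_field_derivative_transform_within_open[OF _ S]) (use assms in \<open>auto simp: zeta_reg_eq\<close>)
  moreover have "s \<noteq> 1" using assms by auto
  ultimately show ?thesis using assms by (simp add: DERIV_imp_deriv zeta_reg_eq field_simps)
qed

text \<open>With \<open>f z = (z - z0)^k * g z\<close> and \<open>g z0\<close> nonzero,
  \<open>(z - z0) * f' / f\<close> equals \<open>k + (z - z0) * g' / g\<close>. Thus the order
  \<open>k\<close> of the zero becomes a limit, which can be taken along any approach to
  \<open>z0\<close>.\<close>

lemma logderiv_tendsto_order:
  assumes hol: "f holomorphic_on S" and S: "open S" "connected S" and "z0 \<in> S" and "\<exists>w\<in>S. f w \<noteq> 0"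
  obtains k :: nat where "((\<lambda>z. (z - z0) * (deriv f z / f z)) \<longlongrightarrow> of_nat k) (at z0)"
    "k = 0 \<longleftrightarrow> f z0 \<noteq> 0" "\<forall>\<^sub>F z in at z0. f z \<noteq> 0"
proof (cases "f z0 = 0")
  case False
  have "isCont f z0" using hol S \<open>z0 \<in> S\<close> by (metis continuous_on_interior holomorphic_on_imp_continuous_on interior_open)
  moreover have "isCont (deriv f) z0"
    using holomorphic_deriv[OF hol S(1)] S \<open>z0 \<in> S\<close> by (metis continuous_on_interior holomorphic_on_imp_continuous_on interior_open)
  ultimately have "isCont (\<lambda>z. (z - z0) * (deriv f z / f z)) z0"
    using False by (intro continuous_intros)
  then have "((\<lambda>z. (z - z0) * (deriv f z / f z)) \<longlongrightarrow> of_nat 0) (at z0)"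
    by (simp add: isCont_def)
  moreover have "\<forall>\<^sub>F z in at z0. f z \<noteq> 0"
    using \<open>isCont f z0\<close> False by (auto simp: isCont_def intro: tendsto_imp_eventually_ne)
  ultimately show ?thesis using that False by blast
next
  case True
  then have "\<not> f constant_on S" using assms(4,5) by (metis constant_on_def)
  then obtain g r n where g: "0 < n" "0 < r" "ball z0 r \<subseteq> S" "g holomorphic_on ball z0 r"
      "\<And>w. w \<in> ball z0 r \<Longrightarrow> f w = (w - z0) ^ n * g w" "\<And>w. w \<in> ball z0 r \<Longrightarrow> g w \<noteq> 0"
    using holomorphic_factor_zero_nonconstant[OF hol S \<open>z0 \<in> S\<close> True] by metis
  have z0: "z0 \<in> ball z0 r" using g by simp
  have near: "\<forall>\<^sub>F z in at z0. z \<in> ball z0 r - {z0}"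
    using eventually_at_in_open[OF open_ball z0] by simp
  have der: "(z - z0) * (deriv f z / f z) = of_nat n + (z - z0) * (deriv g z / g z)" if z: "z \<in> ball z0 r - {z0}" for z
  proof -
    have "(g has_field_derivative deriv g z) (at z)" using holomorphic_derivI[OF g(4)] z by auto
    then have "((\<lambda>w. (w - z0) ^ n * g w) has_field_derivative (of_nat n * (z - z0) ^ (n - 1) * g z + (z - z0) ^ n * deriv g z)) (at z)"
      by (auto intro!: derivative_eq_intros)
    then have "(f has_field_derivative (of_nat n * (z - z0) ^ (n - 1) * g z + (z - z0) ^ n * deriv g z)) (at z)"
      by (rule has_field_derivative_transform_within_open[OF _ open_ball]) (use z g in auto)
    then have df: "deriv f z = of_nat n * (z - z0) ^ (n - 1) * g z + (z - z0) ^ n * deriv g z"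
      by (rule DERIV_imp_deriv)
    have pow: "(z - z0) ^ n = (z - z0) ^ (n - 1) * (z - z0)"
      using g(1) by (metis power_minus_mult)
    have "deriv f z = (z - z0) ^ (n - 1) * (of_nat n * g z + (z - z0) * deriv g z)"
      unfolding df pow by (simp only: distrib_left mult_ac)
    moreover have "f z = (z - z0) ^ (n - 1) * ((z - z0) * g z)"
      using z g(5)[of z] unfolding pow by (simp add: mult.assoc)
    moreover have "d * (p * (m * a + d * b) / (p * (d * a))) = m + d * (b / a)"
      if "d \<noteq> 0" "p \<noteq> 0" "a \<noteq> 0" for a b d m p :: complex
      using that by (simp add: field_simps)
    ultimately show ?thesis using z g(6)[of z] by simp
  qed
  have "isCont g z0" "isCont (deriv g) z0"
    using g(4) holomorphic_deriv[OF g(4)] z0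
    by (metis continuous_on_interior holomorphic_on_imp_continuous_on interior_open open_ball)+
  then have "isCont (\<lambda>z. of_nat n + (z - z0) * (deriv g z / g z)) z0"
    using g(6)[OF z0] by (intro continuous_intros)
  then have "((\<lambda>z. of_nat n + (z - z0) * (deriv g z / g z)) \<longlongrightarrow> of_nat n) (at z0)"
    by (simp add: isCont_def)
  then have "((\<lambda>z. (z - z0) * (deriv f z / f z)) \<longlongrightarrow> of_nat n) (at z0)"
    by (rule Lim_transform_eventually) (use near in eventually_elim, simp only: der)
  moreover have "\<forall>\<^sub>F z in at z0. f z \<noteq> 0"
    using near by eventually_elim (use g(5,6) in auto)
  ultimately show ?thesis using that g(1) True by blast
qed

lemma zeta_reg_order:
  assumes "Re z0 \<ge> 1"
  obtains k :: nat where "((\<lambda>z. (z - z0) * (deriv zeta_reg z / zeta_reg z)) \<longlongrightarrow> of_nat k) (at z0)"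
    "k = 0 \<longleftrightarrow> zeta_reg z0 \<noteq> 0" "\<forall>\<^sub>F z in at z0. zeta_reg z \<noteq> 0"
proof (rule logderiv_tendsto_order[OF zeta_reg_holomorphic, of z0])
  show "connected {s. 0 < Re s}" by (intro convex_connected convex_halfspace_Re_gt)
  show "\<exists>w\<in>{s. 0 < Re s}. zeta_reg w \<noteq> 0" by (intro bexI[of _ 1]) (auto simp: zeta_reg_1)
qed (use assms that in \<open>auto simp: open_halfspace_Re_gt\<close>)

text \<open>No Euler product: the logarithmic derivative coincides near \<open>z0\<close> with the
  continuous function \<open>1 / (z - 1) - mangoldt_series z\<close>, so the order of a zero at
  \<open>z0\<close> must be 0.\<close>

lemma zeta_reg_nonzero_right:
  assumes "Re z0 > 1" shows "zeta_reg z0 \<noteq> 0"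
proof -
  obtain k :: nat where k: "((\<lambda>z. (z - z0) * (deriv zeta_reg z / zeta_reg z)) \<longlongrightarrow> of_nat k) (at z0)"
    "k = 0 \<longleftrightarrow> zeta_reg z0 \<noteq> 0" "\<forall>\<^sub>F z in at z0. zeta_reg z \<noteq> 0"
    using zeta_reg_order[of z0] assms by auto
  have S: "open {s. Re s > 1}" by (rule open_halfspace_Re_gt)
  have "isCont mangoldt_series z0"
    using mangoldt_series_holomorphic S assms
    by (metis continuous_on_interior holomorphic_on_imp_continuous_on interior_open mem_Collect_eq)
  then have "isCont (\<lambda>z. (z - z0) * (1 / (z - 1) - mangoldt_series z)) z0"
    using assms by (intro continuous_intros) auto
  then have "((\<lambda>z. (z - z0) * (1 / (z - 1) - mangoldt_series z)) \<longlongrightarrow> 0) (at z0)"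
    by (simp add: isCont_def)
  moreover have "\<forall>\<^sub>F z in at z0. z \<in> {s. Re s > 1}"
    using eventually_at_in_open'[OF S] assms by auto
  then have "\<forall>\<^sub>F z in at z0. (z - z0) * (1 / (z - 1) - mangoldt_series z) = (z - z0) * (deriv zeta_reg z / zeta_reg z)"
    using k(3) by eventually_elim (auto simp: deriv_zeta_reg)
  ultimately have "((\<lambda>z. (z - z0) * (deriv zeta_reg z / zeta_reg z)) \<longlongrightarrow> 0) (at z0)"
    by (rule Lim_transform_eventually)
  then have "of_nat k = (0::complex)" using tendsto_unique[OF _ k(1)] by (metis at_neq_bot)
  then show ?thesis using k(2) by simp
qed

lemma mangoldt_series_341:
  fixes \<sigma> t :: real
  assumes "\<sigma> > 1"
  shows "Re (3 * mangoldt_series (of_real \<sigma>) + 4 * mangoldt_series (Complex \<sigma> t) + mangoldt_series (Complex \<sigma> (2 * t))) \<ge> 0"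
proof (rule sums_le)
  let ?a = "\<lambda>n. Re (3 * (mangoldt n * of_nat n powr (- of_real \<sigma>)) + 4 * (mangoldt n * of_nat n powr (- Complex \<sigma> t))
     + mangoldt n * of_nat n powr (- Complex \<sigma> (2 * t)))"
  show "?a sums Re (3 * mangoldt_series (of_real \<sigma>) + 4 * mangoldt_series (Complex \<sigma> t) + mangoldt_series (Complex \<sigma> (2 * t)))"
    using assms by (intro sums_Re sums_add sums_mult mangoldt_series_sums) auto
  show "(\<lambda>_. 0::real) sums 0" by simp
  fix n :: nat
  have mang: "(mangoldt n :: complex) = of_real (mangoldt n)" by simp
  show "0 \<le> ?a n"
  proof (cases "n = 0")
    case False
    have re: "Re (of_nat n powr (- Complex \<sigma> y)) = real n powr (-\<sigma>) * cos (y * ln (real n))" for y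
      using False by (simp add: powr_def Ln_of_nat Re_exp mult.commute)
    have "of_real \<sigma> = Complex \<sigma> 0" by (simp add: complex_eq_iff)
    then have "?a n = mangoldt n * real n powr (-\<sigma>) * (3 + 4 * cos (t * ln (real n)) + cos (2 * (t * ln (real n))))"
      unfolding mang by (simp add: re algebra_simps del: of_real_mangoldt)
    also have "3 + 4 * cos x + cos (2 * x) = 2 * (1 + cos x)\<^sup>2" for x :: real
      using cos_double_cos[of x] by (simp add: power2_eq_square algebra_simps)
    finally show ?thesis by (simp add: mangoldt_nonneg)
  qed auto
qed

text \<open>In \<open>mangoldt_series s = 1 / (s - 1) - zeta_reg' / zeta_reg\<close> the first
  summand stays bounded as \<open>t\<close> is nonzero, so after multiplication by
  \<open>\<sigma> - 1\<close> only the order \<open>k\<close> of the zero survives.\<close>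

lemma mangoldt_series_edge_limit:
  assumes "t \<noteq> 0"
  obtains k :: nat where "((\<lambda>\<sigma>. of_real (\<sigma> - 1) * mangoldt_series (Complex \<sigma> t)) \<longlongrightarrow> - of_nat k) (at_right 1)"
    "k = 0 \<longleftrightarrow> zeta_reg (Complex 1 t) \<noteq> 0"
proof -
  let ?z = "Complex 1 t"
  obtain k :: nat where k: "((\<lambda>z. (z - ?z) * (deriv zeta_reg z / zeta_reg z)) \<longlongrightarrow> of_nat k) (at ?z)"
    "k = 0 \<longleftrightarrow> zeta_reg ?z \<noteq> 0"
    using zeta_reg_order[of ?z] by auto
  have lim: "filterlim (\<lambda>\<sigma>. Complex \<sigma> t) (at ?z) (at_right 1)"
    by (auto simp: filterlim_at eventually_at_filter intro!: tendsto_Complex tendsto_intros)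
  have "((\<lambda>\<sigma>. of_real (\<sigma> - 1) / (Complex \<sigma> t - 1) - (Complex \<sigma> t - ?z) * (deriv zeta_reg (Complex \<sigma> t) / zeta_reg (Complex \<sigma> t)))
      \<longlongrightarrow> of_real (1 - 1) / (?z - 1) - of_nat k) (at_right 1)"
    using assms by (intro tendsto_intros filterlim_compose[OF k(1) lim] tendsto_Complex) (auto simp: complex_eq_iff)
  then have "((\<lambda>\<sigma>. of_real (\<sigma> - 1) * mangoldt_series (Complex \<sigma> t)) \<longlongrightarrow> of_real (1 - 1) / (?z - 1) - of_nat k) (at_right 1)"
  proof (rule Lim_transform_eventually)
    show "\<forall>\<^sub>F \<sigma> in at_right 1. of_real (\<sigma> - 1) / (Complex \<sigma> t - 1) - (Complex \<sigma> t - ?z) * (deriv zeta_reg (Complex \<sigma> t) / zeta_reg (Complex \<sigma> t))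
        = of_real (\<sigma> - 1) * mangoldt_series (Complex \<sigma> t)"
      using eventually_at_right_less[of 1]
    proof eventually_elim
      case (elim \<sigma>)
      have "deriv zeta_reg (Complex \<sigma> t) / zeta_reg (Complex \<sigma> t) = 1 / (Complex \<sigma> t - 1) - mangoldt_series (Complex \<sigma> t)"
        using elim zeta_reg_nonzero_right[of "Complex \<sigma> t"] by (simp add: deriv_zeta_reg)
      moreover have "Complex \<sigma> t - ?z = of_real (\<sigma> - 1)" by (simp add: complex_eq_iff)
      ultimately show ?case by (simp add: right_diff_distrib)
    qed
  qed
  then show ?thesis using that k(2) by simp
qed

text \<open>At \<open>t = 0\<close> it is the summand \<open>1 / (s - 1)\<close> that contributes 1,
  whereas \<open>zeta_reg\<close> has no zero there.\<close>

lemma mangoldt_series_pole: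
  "((\<lambda>\<sigma>. of_real (\<sigma> - 1) * mangoldt_series (of_real \<sigma>)) \<longlongrightarrow> 1) (at_right 1)"
proof -
  obtain k :: nat where k: "((\<lambda>z. (z - 1) * (deriv zeta_reg z / zeta_reg z)) \<longlongrightarrow> of_nat k) (at 1)"
    "k = 0 \<longleftrightarrow> zeta_reg 1 \<noteq> 0"
    using zeta_reg_order[of 1] by auto
  then have k0: "((\<lambda>z. (z - 1) * (deriv zeta_reg z / zeta_reg z)) \<longlongrightarrow> 0) (at 1)" by (simp add: zeta_reg_1)
  have lim: "filterlim (complex_of_real) (at 1) (at_right 1)"
    using tendsto_of_real[OF tendsto_ident_at[of "1::real" "{1<..}"], where ?'a = complex]
    by (auto simp: filterlim_at eventually_at_filter)
  have "((\<lambda>\<sigma>. 1 - (complex_of_real \<sigma> - 1) * (deriv zeta_reg (of_real \<sigma>) / zeta_reg (of_real \<sigma>))) \<longlongrightarrow> 1 - 0) (at_right 1)"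
    by (intro tendsto_intros filterlim_compose[OF k0 lim])
  then have "((\<lambda>\<sigma>. of_real (\<sigma> - 1) * mangoldt_series (of_real \<sigma>)) \<longlongrightarrow> 1 - 0) (at_right 1)"
  proof (rule Lim_transform_eventually)
    show "\<forall>\<^sub>F \<sigma> in at_right 1. 1 - (complex_of_real \<sigma> - 1) * (deriv zeta_reg (of_real \<sigma>) / zeta_reg (of_real \<sigma>))
        = of_real (\<sigma> - 1) * mangoldt_series (of_real \<sigma>)"
      using eventually_at_right_less[of 1]
    proof eventually_elim
      case (elim \<sigma>)
      have "deriv zeta_reg (of_real \<sigma>) / zeta_reg (of_real \<sigma>) = 1 / (complex_of_real \<sigma> - 1) - mangoldt_series (of_real \<sigma>)"
        using elim zeta_reg_nonzero_right[of "of_real \<sigma>"] by (simp add: deriv_zeta_reg)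
      moreover have "complex_of_real \<sigma> \<noteq> 1" using elim by auto
      ultimately show ?case by (simp add: right_diff_distrib)
    qed
  qed
  then show ?thesis by simp
qed

text \<open>If \<open>k\<close> and \<open>l\<close> are the orders of the zeros at
  \<open>1 + it\<close> and \<open>1 + 2it\<close>, the trigonometric inequality multiplied by
  \<open>\<sigma> - 1\<close> becomes \<open>3 - 4 * k - l >= 0\<close> in the limit, which forces
  \<open>k = 0\<close>.\<close>

lemma zeta_reg_nonzero:
  assumes "Re s \<ge> 1" shows "zeta_reg s \<noteq> 0"
proof (cases "Re s > 1 \<or> s = 1")
  case True
  then show ?thesis using zeta_reg_nonzero_right zeta_reg_1 by auto
next
  case False
  define t where "t = Im s"
  have s: "s = Complex 1 t" "t \<noteq> 0" using False assms by (auto simp: t_def complex_eq_iff)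
  obtain k :: nat where k: "((\<lambda>\<sigma>. of_real (\<sigma> - 1) * mangoldt_series (Complex \<sigma> t)) \<longlongrightarrow> - of_nat k) (at_right 1)"
    "k = 0 \<longleftrightarrow> zeta_reg (Complex 1 t) \<noteq> 0" using mangoldt_series_edge_limit[OF s(2)] .
  obtain l :: nat where l: "((\<lambda>\<sigma>. of_real (\<sigma> - 1) * mangoldt_series (Complex \<sigma> (2 * t))) \<longlongrightarrow> - of_nat l) (at_right 1)"
    using mangoldt_series_edge_limit[of "2 * t"] s(2) by auto
  have "((\<lambda>\<sigma>. Re (3 * (of_real (\<sigma> - 1) * mangoldt_series (of_real \<sigma>)) + 4 * (of_real (\<sigma> - 1) * mangoldt_series (Complex \<sigma> t))
      + of_real (\<sigma> - 1) * mangoldt_series (Complex \<sigma> (2 * t)))) \<longlongrightarrow> Re (3 * 1 + 4 * (- of_nat k) + (- of_nat l))) (at_right 1)"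
    by (intro tendsto_intros mangoldt_series_pole k l)
  moreover have "\<forall>\<^sub>F \<sigma> in at_right 1. Re (3 * (of_real (\<sigma> - 1) * mangoldt_series (of_real \<sigma>)) + 4 * (of_real (\<sigma> - 1) * mangoldt_series (Complex \<sigma> t))
      + of_real (\<sigma> - 1) * mangoldt_series (Complex \<sigma> (2 * t))) \<ge> 0"
    using eventually_at_right_less[of 1]
  proof eventually_elim
    case (elim \<sigma>)
    have "3 * (of_real (\<sigma> - 1) * mangoldt_series (of_real \<sigma>)) + 4 * (of_real (\<sigma> - 1) * mangoldt_series (Complex \<sigma> t))
      + of_real (\<sigma> - 1) * mangoldt_series (Complex \<sigma> (2 * t))
      = of_real (\<sigma> - 1) * (3 * mangoldt_series (of_real \<sigma>) + 4 * mangoldt_series (Complex \<sigma> t) + mangoldt_series (Complex \<sigma> (2 * t)))"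
      by (simp add: algebra_simps)
    moreover have "Re (of_real (\<sigma> - 1) * w) = (\<sigma> - 1) * Re w" for w by simp
    ultimately show ?case using mangoldt_series_341[OF elim, of t] elim by (simp only: mult_nonneg_nonneg)
  qed
  ultimately have "0 \<le> Re (3 * 1 + 4 * (- of_nat k) + (- of_nat l))"
    by (intro tendsto_lowerbound) auto
  then have "k = 0" by simp
  then show ?thesis using k s by simp
qed

section \<open>The prime number theorem\<close>

definition psi :: "nat \<Rightarrow> real" where
  "psi n = (\<Sum>k\<le>n. mangoldt k)"

lemma psi_0 [simp]: "psi 0 = 0"
  by (simp add: psi_def)

lemma psi_Suc: "psi (Suc n) = psi n + mangoldt (Suc n)"
  by (simp add: psi_def)

lemma psi_mono: "m \<le> n \<Longrightarrow> psi m \<le> psi n"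
  unfolding psi_def by (intro sum_mono2) (auto simp: mangoldt_nonneg)

lemma psi_nonneg: "psi n \<ge> 0"
  unfolding psi_def by (intro sum_nonneg mangoldt_nonneg)

text \<open>In the step from \<open>n\<close> to \<open>n + 1\<close> the quotient by
  \<open>d\<close> grows by one exactly when \<open>d\<close> divides \<open>n + 1\<close>. The
  range \<open>N\<close> is kept apart from \<open>n\<close> so that two factorials can be expanded
  over the same range.\<close>

lemma ln_fact_eq_sum_mangoldt:
  "n \<le> N \<Longrightarrow> ln (fact n) = (\<Sum>d=1..N. mangoldt d * real (n div d))"
proof (induction n)
  case (Suc n)
  have "(\<Sum>d=1..N. mangoldt d * real (Suc n div d))
      = (\<Sum>d=1..N. mangoldt d * real (n div d) + (if d dvd Suc n then mangoldt d else 0))"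
    by (intro sum.cong refl) (auto simp: div_Suc dvd_eq_mod_eq_0 algebra_simps)
  also have "\<dots> = ln (fact n) + (\<Sum>d | d \<in> {1..N} \<and> d dvd Suc n. mangoldt d)"
    unfolding sum.distrib sum.inter_filter[OF finite_atLeastAtMost] using Suc by simp
  also have "{d. d \<in> {1..N} \<and> d dvd Suc n} = {d. d dvd Suc n}"
    using Suc.prems by (auto dest: dvd_imp_le intro: Suc_leI dvd_pos_nat)
  also have "(\<Sum>d | d dvd Suc n. mangoldt d :: real) = ln (real (Suc n))"
    using mangoldt_sum[of "Suc n", where ?'a = real] by simp
  also have "ln (fact n) + ln (real (Suc n)) = ln (fact (Suc n))"
    by (simp add: ln_mult_pos fact_Suc add.commute del: of_nat_Suc)
  finally show ?case by simp
qed auto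

text \<open>Chebyshev's argument: the logarithm of the central binomial coefficient is a sum of
  \<open>mangoldt d\<close> with nonnegative factors, and these are at least 1 for
  \<open>m < d <= 2 * m\<close>.\<close>

lemma psi_double_le: "psi (2 * m) - psi m \<le> real m * ln 4"
proof -
  have "psi (2 * m) - psi m = (\<Sum>d\<in>{..2*m} - {..m}. mangoldt d)"
    unfolding psi_def by (subst sum_diff) auto
  also have "\<dots> = (\<Sum>d\<in>{1..2*m}. if d > m then mangoldt d else 0)"
    by (intro sum.mono_neutral_cong_left) auto
  also have "\<dots> \<le> (\<Sum>d=1..2*m. mangoldt d * (real (2 * m div d) - 2 * real (m div d)))"
  proof (rule sum_mono)
    fix d assume d: "d \<in> {1..2*m}"
    have "m div d * d \<le> m" by simp
    then have "2 * (m div d) * d \<le> 2 * m" by linarith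
    then have "2 * (m div d) \<le> 2 * m div d"
      using d by (subst less_eq_div_iff_mult_less_eq) auto
    then have "real (2 * m div d) - 2 * real (m div d) \<ge> 0" by linarith
    moreover have "2 * m div d \<ge> 1" if "d > m" using d that by (simp add: Suc_le_eq div_greater_zero_iff)
    ultimately show "(if d > m then mangoldt d else 0) \<le> mangoldt d * (real (2 * m div d) - 2 * real (m div d))"
      using mangoldt_nonneg[of d] by (auto intro!: mult_nonneg_nonneg simp: mult_le_cancel_left1)
  qed
  also have "\<dots> = ln (fact (2 * m)) - 2 * ln (fact m)"
    by (subst (1 2) ln_fact_eq_sum_mangoldt[of _ "2 * m"])
       (auto simp: right_diff_distrib sum_subtractf sum_distrib_left mult_ac)
  also have "fact (2 * m) = (fact m * fact m * real (2 * m choose m) :: real)"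
  proof -
    have "fact m * fact (2 * m - m) * (2 * m choose m) = (fact (2 * m) :: nat)"
      by (rule binomial_fact_lemma) simp
    then have "real (fact (2 * m)) = real (fact m * fact m * (2 * m choose m))" by simp
    then show ?thesis by (simp only: of_nat_fact of_nat_mult)
  qed
  also have "ln (fact m * fact m * real (2 * m choose m)) - 2 * ln (fact m) = ln (real (2 * m choose m))"
    by (simp add: ln_mult_pos)
  also have "\<dots> \<le> ln (4 ^ m)"
  proof (subst ln_le_cancel_iff)
    have "(2 * m choose m) \<le> 2 ^ (2 * m)" by (rule binomial_le_pow2)
    then have "real (2 * m choose m) \<le> real (2 ^ (2 * m))" by (simp only: of_nat_le_iff)
    then show "real (2 * m choose m) \<le> 4 ^ m" by (simp add: power_mult)
  qed auto
  also have "\<dots> = real m * ln 4" by (simp add: ln_realpow)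
  finally show ?thesis .
qed

text \<open>Halving gives \<open>4 m + m ln 4 <= 6 m\<close> at \<open>2 * m\<close>; the remaining
  slack of \<open>2 * m\<close> pays for the one extra term when \<open>n\<close> is odd.\<close>

lemma psi_le: "psi n \<le> 4 * real n"
proof (induction n rule: less_induct)
  case (less n)
  define m where "m = n div 2"
  have ln4: "ln 4 \<le> (2::real)"
    using ln_le_minus_one[of "2::real"] ln_realpow[of "2::real" 2] by simp
  show ?case
  proof (cases "n = 0")
    case False
    then have "m < n" by (simp add: m_def)
    then have IH: "psi m \<le> 4 * real m" by (rule less)
    have *: "psi (2 * m) \<le> 6 * real m"
      using psi_double_le[of m] IH mult_left_mono[OF ln4, of "real m"] by simp
    show ?thesis
    proof (cases "even n")
      case True
      then have "n = 2 * m" by (simp add: m_def)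
      then show ?thesis using * by simp
    next
      case odd: False
      then have n: "n = Suc (2 * m)" by (simp add: m_def)
      have "mangoldt n \<le> ln (real n)" by (rule mangoldt_le_ln)
      also have "\<dots> \<le> 2 * real m" using ln_le_minus_one[of "real n"] n by simp
      finally show ?thesis using * n by (simp add: psi_Suc)
    qed
  qed simp
qed

text \<open>Summation by parts. By \<open>psi_le\<close> the boundary term is of order
  \<open>N powr (1 - Re s)\<close> and disappears for \<open>Re s > 1\<close>.\<close>

lemma psi_abel_sums:
  assumes s: "Re s > 1"
  shows "(\<lambda>n. of_real (psi n) * (of_nat n powr (-s) - of_nat (Suc n) powr (-s))) sums mangoldt_series s"
proof -
  let ?a = "\<lambda>n. of_nat n powr (-s) :: complex"
  have partial: "(\<Sum>n<Suc N. of_real (psi n) * (?a n - ?a (Suc n))) = (\<Sum>n<Suc N. mangoldt n * ?a n) - of_real (psi N) * ?a (Suc N)" for N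
    by (induction N) (simp_all add: psi_Suc algebra_simps del: of_nat_Suc)
  have "(\<lambda>N. of_real (psi N) * ?a (Suc N)) \<longlonglongrightarrow> 0"
  proof (rule tendsto_0_le[where K = 4])
    show "(\<lambda>N. of_nat (Suc N) powr (1 - s) :: complex) \<longlonglongrightarrow> 0"
      by (rule LIMSEQ_Suc[OF of_nat_powr_tendsto_0]) (use s in simp)
    have "norm (of_real (psi N) * ?a (Suc N)) \<le> norm (of_nat (Suc N) powr (1 - s) :: complex) * 4" for N
    proof -
      have "norm (of_real (psi N) * ?a (Suc N)) = psi N * real (Suc N) powr (- Re s)"
        by (simp add: norm_mult norm_of_nat_powr psi_nonneg del: of_nat_Suc)
      also have "\<dots> \<le> (4 * real (Suc N)) * real (Suc N) powr (- Re s)"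
        using psi_le[of N] by (intro mult_right_mono) auto
      also have "\<dots> = norm (of_nat (Suc N) powr (1 - s) :: complex) * 4"
      proof -
        have "norm (of_nat (Suc N) powr (1 - s) :: complex) = real (Suc N) powr (1 - Re s)"
          by (simp add: norm_of_nat_powr del: of_nat_Suc)
        then show ?thesis by (simp add: powr_diff powr_minus divide_inverse del: of_nat_Suc)
      qed
      finally show ?thesis .
    qed
    then show "\<forall>\<^sub>F N in sequentially. norm (of_real (psi N) * ?a (Suc N)) \<le> norm (of_nat (Suc N) powr (1 - s) :: complex) * 4"
      by (intro always_eventually) auto
  qed
  then have "(\<lambda>N. (\<Sum>n<Suc N. mangoldt n * ?a n) - of_real (psi N) * ?a (Suc N)) \<longlonglongrightarrow> mangoldt_series s - 0"
    using mangoldt_series_sums[OF s] by (intro tendsto_diff LIMSEQ_Suc) (auto simp: sums_def)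
  then have "(\<lambda>N. \<Sum>n<Suc N. of_real (psi n) * (?a n - ?a (Suc n))) \<longlonglongrightarrow> mangoldt_series s"
    unfolding partial by simp
  then show ?thesis unfolding sums_def by (rule LIMSEQ_imp_Suc)
qed

text \<open>\<open>powr_remainder n (s + 1)\<close> is the error made when
  \<open>n powr (-s) - (n + 1) powr (-s)\<close> is replaced by \<open>s * n powr (-s - 1)\<close>.
  Weighted with \<open>psi n\<close>, these errors still sum for \<open>Re s > 0\<close>, so the
  replacement costs only a holomorphic function.\<close>

definition psi_remainder :: "complex \<Rightarrow> complex" where
  "psi_remainder s = (\<Sum>n. of_real (psi n) * powr_remainder n (s + 1))"

lemma psi_remainder_bound:
  assumes "\<sigma> > (0::real)"
  shows "\<exists>M. summable M \<and> (\<forall>n s. Re s \<ge> \<sigma> \<longrightarrow> norm s \<le> r \<longrightarrow> norm (of_real (psi n) * powr_remainder n (s + 1)) \<le> M n)"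
proof (intro exI conjI allI impI)
  show "summable (\<lambda>n. 4 * (r * (1 + r)) * real n powr (-\<sigma> - 1))"
    using assms by (intro summable_mult) (auto simp: summable_real_powr_iff)
  fix n s assume s: "Re s \<ge> \<sigma>" "norm s \<le> r"
  show "norm (of_real (psi n) * powr_remainder n (s + 1)) \<le> 4 * (r * (1 + r)) * real n powr (-\<sigma> - 1)"
  proof (cases "n = 0")
    case False
    have r: "r \<ge> 0" using order_trans[OF norm_ge_zero s(2)] .
    have "norm (of_real (psi n) * powr_remainder n (s + 1)) \<le> (4 * real n) * (norm (1 - (s + 1)) * norm (s + 1) * real n powr (- Re (s + 1) - 1))"
      unfolding norm_mult using False s assms psi_le[of n] psi_nonneg[of n]
      by (intro mult_mono norm_powr_remainder_le) auto
    also have "\<dots> \<le> (4 * real n) * ((r * (1 + r)) * real n powr (- \<sigma> - 2))"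
      using s False r norm_triangle_ineq[of s 1]
      by (intro mult_left_mono mult_mono powr_mono) auto
    also have "\<dots> = 4 * (r * (1 + r)) * real n powr (-\<sigma> - 1)"
      using False powr_add[of "real n" 1 "-\<sigma> - 2"] by (simp add: minus_diff_commute)
    finally show ?thesis .
  qed simp
qed

lemma psi_remainder_holomorphic: "psi_remainder holomorphic_on {s. Re s > 0}"
  unfolding psi_remainder_def[abs_def]
  by (rule halfplane_series_holomorphic[OF _ psi_remainder_bound]) (auto intro!: holomorphic_intros)

lemma psi_remainder_sums:
  assumes "Re s > 0"
  shows "(\<lambda>n. of_real (psi n) * powr_remainder n (s + 1)) sums psi_remainder s"
  unfolding psi_remainder_def
  by (intro summable_sums summable_norm_cancel[OF halfplane_series_summable[OF _ psi_remainder_bound assms]])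
     (auto intro!: holomorphic_intros)

lemma psi_dirichlet_sums:
  assumes s: "Re s > 1"
  shows "(\<lambda>n. of_real (psi n) * of_nat n powr (-s - 1)) sums ((psi_remainder s + mangoldt_series s) / s)"
proof -
  have "s \<noteq> 0" using s by auto
  have "(\<lambda>n. (of_real (psi n) * powr_remainder n (s + 1) + of_real (psi n) * (of_nat n powr (-s) - of_nat (Suc n) powr (-s))) / s)
     sums ((psi_remainder s + mangoldt_series s) / s)"
    using s by (intro sums_divide sums_add psi_remainder_sums psi_abel_sums) auto
  moreover have "(of_real (psi n) * powr_remainder n (s + 1) + of_real (psi n) * (of_nat n powr (-s) - of_nat (Suc n) powr (-s))) / s
      = of_real (psi n) * of_nat n powr (-s - 1)" for n
    using \<open>s \<noteq> 0\<close> by (simp add: powr_remainder_def field_simps minus_diff_commute)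
  ultimately show ?thesis by simp
qed

text \<open>The series with coefficients \<open>psi n / n\<close> and the zeta series both have a
  simple pole of residue 1 at \<open>s = 1\<close>; subtracting cancels it. The non-vanishing of
  \<open>zeta_reg\<close> does the rest of the line, and the Tauberian theorem is used in the
  variable \<open>z = s - 1\<close>.\<close>

lemma psi_deviation_series_converges: "convergent (\<lambda>N. \<Sum>n=1..N. (psi n - real n) / (real n)\<^sup>2)"
proof -
  define D where "D = (\<lambda>s. if s = 1 then deriv zeta_reg 1 else (zeta_reg s - zeta_reg 1) / (s - 1))"
  \<comment> \<open>The difference of the two series with the poles already cancelled:
    \<open>1 / (s * (s - 1)) - 1 / (s - 1)\<close> has become \<open>- 1 / s\<close>, and
    \<open>D\<close> is the regular part of the zeta function.\<close>
  define G where "G s = - D s - 1 / s - deriv zeta_reg s / (s * zeta_reg s) + psi_remainder s / s" for s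
  define U where "U = {s. Re s > 0} \<inter> zeta_reg -` (- {0})"
  have H: "open {s. Re s > 0}" by (rule open_halfspace_Re_gt)
  have U: "open U" unfolding U_def
    by (intro continuous_open_preimage holomorphic_on_imp_continuous_on zeta_reg_holomorphic H) auto
  have "D holomorphic_on {s. Re s > 0}"
    unfolding D_def by (rule pole_lemma_open[OF zeta_reg_holomorphic H])
  then have holG: "G holomorphic_on U"
    unfolding G_def U_def
    by (intro holomorphic_intros holomorphic_on_subset[OF holomorphic_deriv[OF zeta_reg_holomorphic H]]
         holomorphic_on_subset[OF zeta_reg_holomorphic] holomorphic_on_subset[OF psi_remainder_holomorphic])
       (auto elim: holomorphic_on_subset)
  have Geq: "G s = (psi_remainder s + mangoldt_series s) / s - zeta_series s" if s: "Re s > 1" for s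
  proof -
    have nz: "s \<noteq> 0" "s \<noteq> 1" "s - 1 \<noteq> 0" "zeta_reg s \<noteq> 0" using s zeta_reg_nonzero[of s] by auto
    have L: "mangoldt_series s = 1 / (s - 1) - deriv zeta_reg s / zeta_reg s"
      using deriv_zeta_reg[OF s] nz by simp
    have Zt: "zeta_series s = zeta_reg s / (s - 1)" using zeta_reg_eq[OF s] nz by simp
    have Ds: "D s = (zeta_reg s - 1) / (s - 1)" using nz by (simp add: D_def zeta_reg_1)
    have "- ((z - 1) / (s - 1)) - 1 / s - w / (s * z) + e / s = (e + (1 / (s - 1) - w / z)) / s - z / (s - 1)"
      if "z \<noteq> 0" for z w e :: complex
      using nz that by (simp add: divide_simps) (simp add: algebra_simps)
    then show ?thesis unfolding G_def L Zt Ds using nz by blast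
  qed
  define b where "b n = complex_of_real ((psi n - real n) / real n)" for n
  have "(\<lambda>N. \<Sum>n=1..N. b n / of_nat n) \<longlonglongrightarrow> G (0 + 1)"
  proof (rule newman_tauberian[where g = "\<lambda>z. G (z + 1)"])
    show "norm (b n) \<le> 4" for n
    proof (cases "n = 0")
      case False
      have "\<bar>psi n - real n\<bar> \<le> 4 * real n" using psi_le[of n] psi_nonneg[of n] by linarith
      then show ?thesis using False by (simp add: b_def norm_divide field_simps del: of_real_diff of_real_divide)
    qed (simp add: b_def)
    show "open ((\<lambda>z. z + 1) -` U)" by (intro open_vimage U continuous_intros)
    show "{z. Re z \<ge> 0} \<subseteq> (\<lambda>z. z + 1) -` U"
      using zeta_reg_nonzero by (auto simp: U_def)
    show "(\<lambda>z. G (z + 1)) holomorphic_on (\<lambda>z. z + 1) -` U"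
      by (rule holomorphic_on_compose_gen[OF _ holG, unfolded o_def]) (auto intro!: holomorphic_intros)
    fix z :: complex assume z: "Re z > 0"
    then have s: "Re (z + 1) > 1" by simp
    have "(\<lambda>n. of_real (psi n) * of_nat n powr (- (z + 1) - 1) - of_nat n powr (- (z + 1))) sums G (z + 1)"
      unfolding Geq[OF s] by (intro sums_diff psi_dirichlet_sums zeta_series_sums s)
    moreover have "of_real (psi n) * of_nat n powr (- (z + 1) - 1) - of_nat n powr (- (z + 1)) = b n * of_nat n powr (- 1 - z)" for n
    proof (cases "n = 0")
      case False
      define A where "A = (of_nat n powr (- (z + 1) - 1) :: complex)"
      have A: "of_nat n powr (- (z + 1)) = of_nat n * A"
        using False powr_add[of "of_nat n :: complex" 1 "- (z + 1) - 1"] by (simp add: A_def minus_diff_commute)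
      have "- 1 - z = - (z + 1)" by simp
      moreover have "b n * (of_nat n * A) = of_real (psi n) * A - of_nat n * A"
        using False by (simp add: b_def left_diff_distrib[symmetric])
      ultimately show ?thesis by (simp only: A flip: A_def)
    qed auto
    ultimately have "(\<lambda>n. b n * of_nat n powr (- 1 - z)) sums G (z + 1)" by simp
    moreover have "(\<Sum>n\<le>N. b n * of_nat n powr (- 1 - z)) = (\<Sum>n=1..N. b n * of_nat n powr (- 1 - z))" for N
      by (intro sum.mono_neutral_right) (auto simp: not_le)
    ultimately show "(\<lambda>N. \<Sum>n=1..N. b n * of_nat n powr (- 1 - z)) \<longlonglongrightarrow> G (z + 1)"
      by (simp add: sums_def_le)
  qed
  then have "(\<lambda>N. Re (\<Sum>n=1..N. b n / of_nat n)) \<longlonglongrightarrow> Re (G (0 + 1))"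
    by (rule tendsto_Re)
  moreover have "Re (\<Sum>n=1..N. b n / of_nat n) = (\<Sum>n=1..N. (psi n - real n) / (real n)\<^sup>2)" for N
    unfolding Re_sum by (intro sum.cong) (auto simp: b_def power2_eq_square)
  ultimately show ?thesis by (auto simp: convergent_def)
qed


section \<open>From the convergent series to the asymptotics of \<open>psi\<close>\<close>

lemma floor_scale_tendsto:
  fixes c :: real
  assumes "c > 0"
  shows "(\<lambda>n. real (nat \<lfloor>c * real n\<rfloor>) / real n) \<longlonglongrightarrow> c"
proof (rule tendsto_sandwich)
  show "(\<lambda>n. c - 1 / real n) \<longlonglongrightarrow> c" by real_asymp
  have b: "c * real n - 1 \<le> real (nat \<lfloor>c * real n\<rfloor>)" "real (nat \<lfloor>c * real n\<rfloor>) \<le> c * real n" for n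
  proof -
    have "c * real n \<ge> 0" using assms by simp
    then show "c * real n - 1 \<le> real (nat \<lfloor>c * real n\<rfloor>)" "real (nat \<lfloor>c * real n\<rfloor>) \<le> c * real n" by linarith+
  qed
  show "\<forall>\<^sub>F n in sequentially. c - 1 / real n \<le> real (nat \<lfloor>c * real n\<rfloor>) / real n"
    using eventually_gt_at_top[of 0]
  proof eventually_elim
    case (elim n)
    then show ?case using divide_right_mono[OF b(1)[of n], of "real n"] by (simp add: diff_divide_distrib)
  qed
  show "\<forall>\<^sub>F n in sequentially. real (nat \<lfloor>c * real n\<rfloor>) / real n \<le> c"
    using eventually_gt_at_top[of 0]
  proof eventually_elim
    case (elim n)
    then show ?case using divide_right_mono[OF b(2)[of n], of "real n"] by simp
  qed
qed simp

lemma filterlim_floor_scale: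
  fixes c :: real
  assumes "c > 0"
  shows "filterlim (\<lambda>n. nat \<lfloor>c * real n\<rfloor>) at_top sequentially"
  using assms
  by (intro filterlim_compose[OF filterlim_nat_sequentially] filterlim_compose[OF filterlim_floor_sequentially]
       filterlim_tendsto_pos_mult_at_top[OF tendsto_const] filterlim_real_sequentially)
text \<open>On the block from \<open>n\<close> to \<open>m\<close>, monotonicity lets
  \<open>psi k\<close> be replaced by its value at either end. A small difference of partial sums
  thus bounds \<open>psi n\<close> from above and \<open>psi m\<close> from below.\<close>

lemma psi_deviation_bounds:
  assumes "1 \<le> n" "n < m"
  shows "psi n * (real m - real n) / (real m)\<^sup>2 - (real m - real n) / real n
      \<le> (\<Sum>k=1..m. (psi k - real k) / (real k)\<^sup>2) - (\<Sum>k=1..n. (psi k - real k) / (real k)\<^sup>2)" (is "?l \<le> ?d")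
    and "(\<Sum>k=1..m. (psi k - real k) / (real k)\<^sup>2) - (\<Sum>k=1..n. (psi k - real k) / (real k)\<^sup>2)
      \<le> psi m * (real m - real n) / (real n)\<^sup>2 - (real m - real n) / real m" (is "_ \<le> ?u")
proof -
  let ?a = "\<lambda>k. (psi k - real k) / (real k)\<^sup>2"
  have d: "?d = (\<Sum>k\<in>{n<..m}. ?a k)"
  proof -
    have "{1..m} = {1..n} \<union> {n<..m}" using assms by auto
    moreover have "(\<Sum>k\<in>{1..n} \<union> {n<..m}. ?a k) = (\<Sum>k=1..n. ?a k) + (\<Sum>k\<in>{n<..m}. ?a k)"
      by (rule sum.union_disjoint) auto
    ultimately show ?thesis by simp
  qed
  have bounds: "psi n / (real m)\<^sup>2 - 1 / real n \<le> ?a k" "?a k \<le> psi m / (real n)\<^sup>2 - 1 / real m"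
    if k: "k \<in> {n<..m}" for k
  proof -
    have eq: "?a k = psi k / (real k)\<^sup>2 - 1 / real k"
      using k by (simp add: diff_divide_distrib power2_eq_square)
    have "psi n / (real m)\<^sup>2 \<le> psi k / (real k)\<^sup>2"
      using k assms psi_nonneg by (intro frac_le psi_mono power_mono) auto
    moreover have "1 / real k \<le> 1 / real n" using k assms by (intro frac_le) auto
    ultimately show "psi n / (real m)\<^sup>2 - 1 / real n \<le> ?a k" unfolding eq by linarith
    have "psi k / (real k)\<^sup>2 \<le> psi m / (real n)\<^sup>2"
      using k assms psi_nonneg by (intro frac_le psi_mono power_mono) auto
    moreover have "1 / real m \<le> 1 / real k" using k assms by (intro frac_le) auto
    ultimately show "?a k \<le> psi m / (real n)\<^sup>2 - 1 / real m" unfolding eq by linarith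
  qed
  have card: "real (card {n<..m}) = real m - real n" using assms by simp
  have "?l = real (card {n<..m}) * (psi n / (real m)\<^sup>2 - 1 / real n)"
    unfolding card by (simp add: algebra_simps diff_divide_distrib)
  also have "\<dots> \<le> (\<Sum>k\<in>{n<..m}. ?a k)" using bounds(1) by (intro sum_bounded_below) auto
  finally show "?l \<le> ?d" unfolding d .
  have "(\<Sum>k\<in>{n<..m}. ?a k) \<le> real (card {n<..m}) * (psi m / (real n)\<^sup>2 - 1 / real m)"
    using bounds(2) by (intro sum_bounded_above) auto
  also have "\<dots> = ?u" unfolding card by (simp add: algebra_simps diff_divide_distrib)
  finally show "?d \<le> ?u" unfolding d .
qed

text \<open>Partial sums over blocks whose ends have a fixed ratio \<open>1 + e\<close> or
  \<open>1 - e\<close> differ by \<open>o(1)\<close>. Solving the block bounds for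
  \<open>psi n / n\<close> leaves the limits \<open>(1 + e)^2\<close> and \<open>(1 - e)^2\<close>,
  with \<open>e\<close> arbitrarily small.\<close>

theorem psi_asymptotics: "(\<lambda>n. psi n / real n) \<longlonglongrightarrow> 1"
proof -
  define S where "S N = (\<Sum>n=1..N. (psi n - real n) / (real n)\<^sup>2)" for N
  obtain l where l: "S \<longlonglongrightarrow> l"
    using psi_deviation_series_converges unfolding S_def convergent_def by blast
  have upper: "\<forall>\<^sub>F n in sequentially. psi n / real n < a" if "a > (1 + e)\<^sup>2" "e > 0" for a e :: real
  proof -
    define m where "m n = nat \<lfloor>(1 + e) * real n\<rfloor>" for n :: nat
    \<comment> \<open>Because of the floor the ratio is \<open>1 + e\<close> only in the limit; the
      bounds are kept in terms of the actual ratio \<open>x n\<close>.\<close>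
    define x where "x n = real (m n) / real n" for n
    have x: "x \<longlonglongrightarrow> 1 + e" and m: "filterlim m at_top at_top"
      using floor_scale_tendsto[of "1 + e"] filterlim_floor_scale[of "1 + e"] that by (auto simp: x_def[abs_def] m_def[abs_def])
    have "(\<lambda>n. (S (m n) - S n) * (x n)\<^sup>2 / (x n - 1) + (x n)\<^sup>2) \<longlonglongrightarrow> (l - l) * (1 + e)\<^sup>2 / (1 + e - 1) + (1 + e)\<^sup>2"
      using that by (intro tendsto_intros x l filterlim_compose[OF l m]) auto
    then have "\<forall>\<^sub>F n in sequentially. (S (m n) - S n) * (x n)\<^sup>2 / (x n - 1) + (x n)\<^sup>2 < a"
      using that by (intro order_tendstoD) auto
    moreover have "\<forall>\<^sub>F n in sequentially. x n > 1" by (rule order_tendstoD(1)[OF x]) (use that in simp)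
    ultimately show ?thesis using eventually_ge_at_top[of 1]
    proof eventually_elim
      case (elim n)
      have n: "real n > 0" using elim by simp
      have mx: "real (m n) = x n * real n" using n by (simp add: x_def)
      then have "real (m n) > real n" using elim n by simp
      then have "psi n * (real (m n) - real n) / (real (m n))\<^sup>2 - (real (m n) - real n) / real n \<le> S (m n) - S n"
        unfolding S_def using elim by (intro psi_deviation_bounds) auto
      also have "psi n * (real (m n) - real n) / (real (m n))\<^sup>2 - (real (m n) - real n) / real n
          = (psi n / real n) * ((x n - 1) / (x n)\<^sup>2) - (x n - 1)"
        unfolding mx using n elim by (simp add: field_simps power2_eq_square)
      finally have "(psi n / real n) * ((x n - 1) / (x n)\<^sup>2) \<le> S (m n) - S n + (x n - 1)" by simp
      then have "psi n / real n \<le> (S (m n) - S n + (x n - 1)) / ((x n - 1) / (x n)\<^sup>2)"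
        using elim by (subst pos_le_divide_eq) auto
      also have "\<dots> = (S (m n) - S n) * (x n)\<^sup>2 / (x n - 1) + (x n)\<^sup>2"
        using elim by (simp add: field_simps)
      finally show ?case using elim by linarith
    qed
  qed
  have lower: "\<forall>\<^sub>F n in sequentially. psi n / real n > a" if "a < (1 - e)\<^sup>2" "e > 0" "e < 1" for a e :: real
  proof -
    define m where "m n = nat \<lfloor>(1 - e) * real n\<rfloor>" for n :: nat
    define x where "x n = real (m n) / real n" for n
    have x: "x \<longlonglongrightarrow> 1 - e" and m: "filterlim m at_top at_top"
      using floor_scale_tendsto[of "1 - e"] filterlim_floor_scale[of "1 - e"] that by (auto simp: x_def[abs_def] m_def[abs_def])
    have "(\<lambda>n. (S n - S (m n)) * (x n)\<^sup>2 / (1 - x n) + (x n)\<^sup>2) \<longlonglongrightarrow> (l - l) * (1 - e)\<^sup>2 / (1 - (1 - e)) + (1 - e)\<^sup>2"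
      using that by (intro tendsto_intros x l filterlim_compose[OF l m]) auto
    then have "\<forall>\<^sub>F n in sequentially. (S n - S (m n)) * (x n)\<^sup>2 / (1 - x n) + (x n)\<^sup>2 > a"
      using that by (intro order_tendstoD) auto
    moreover have "\<forall>\<^sub>F n in sequentially. x n < 1" by (rule order_tendstoD(2)[OF x]) (use that in simp)
    moreover have "\<forall>\<^sub>F n in sequentially. x n > 0" by (rule order_tendstoD(1)[OF x]) (use that in simp)
    ultimately show ?thesis using eventually_ge_at_top[of 1]
    proof eventually_elim
      case (elim n)
      have n: "real n > 0" using elim by simp
      have mx: "real (m n) = x n * real n" using n by (simp add: x_def)
      have "real (m n) < real n" using mx elim n by simp
      moreover have "real (m n) > 0" using mx elim n by simp
      ultimately have "S n - S (m n) \<le> psi n * (real n - real (m n)) / (real (m n))\<^sup>2 - (real n - real (m n)) / real n"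
        unfolding S_def by (intro psi_deviation_bounds) auto
      also have "\<dots> = (psi n / real n) * ((1 - x n) / (x n)\<^sup>2) - (1 - x n)"
        unfolding mx using n elim by (simp add: field_simps power2_eq_square)
      finally have "S n - S (m n) + (1 - x n) \<le> (psi n / real n) * ((1 - x n) / (x n)\<^sup>2)" by simp
      then have "(S n - S (m n) + (1 - x n)) / ((1 - x n) / (x n)\<^sup>2) \<le> psi n / real n"
        using elim by (subst pos_divide_le_eq) auto
      moreover have "(S n - S (m n) + (1 - x n)) / ((1 - x n) / (x n)\<^sup>2) = (S n - S (m n)) * (x n)\<^sup>2 / (1 - x n) + (x n)\<^sup>2"
        using elim by (simp add: field_simps)
      ultimately show ?case using elim by linarith
    qed
  qed
  show ?thesis
  proof (rule order_tendstoI)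
    fix a :: real assume a: "a < 1"
    define e where "e = min (1/2) ((1 - a) / 4)"
    have "e > 0" "e < 1" "4 * e \<le> 1 - a" using a by (auto simp: e_def min_def)
    moreover have "(1 - e)\<^sup>2 \<ge> 1 - 2 * e" by (simp add: power2_eq_square algebra_simps)
    ultimately show "\<forall>\<^sub>F n in sequentially. a < psi n / real n" by (intro lower[of a e]) linarith+
  next
    fix a :: real assume a: "a > 1"
    \<comment> \<open>\<open>e <= 1\<close> gives \<open>(1 + e)^2 <= 1 + 3 * e\<close>, and this is
      below \<open>a\<close> since \<open>4 * e <= a - 1\<close>.\<close>
    define e where "e = min 1 ((a - 1) / 4)"
    have "e > 0" "e \<le> 1" "4 * e \<le> a - 1" using a by (auto simp: e_def min_def)
    moreover have "e * e \<le> e * 1" using \<open>e > 0\<close> \<open>e \<le> 1\<close> by (intro mult_left_mono) auto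
    moreover have "(1 + e)\<^sup>2 = 1 + 2 * e + e * e" by (simp add: power2_eq_square algebra_simps)
    ultimately show "\<forall>\<^sub>F n in sequentially. psi n / real n < a"
      by (intro upper[of e a]) linarith+
  qed
qed

section \<open>Counting tuples of odd primes\<close>

definition odd_primes_upto :: "nat \<Rightarrow> nat set" where
  "odd_primes_upto n = {p. prime p \<and> odd p \<and> p \<le> n}"

lemma finite_odd_primes_upto [simp]: "finite (odd_primes_upto n)"
  unfolding odd_primes_upto_def by (rule finite_subset[of _ "{..n}"]) auto

lemma card_odd_primes_upto_le: "card (odd_primes_upto n) \<le> n"
proof -
  have "odd_primes_upto n \<subseteq> {1..n}" by (auto simp: odd_primes_upto_def Suc_le_eq prime_gt_0_nat)
  from card_mono[OF _ this] show ?thesis by simp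
qed

text \<open>There are at most \<open>y\<close> primes up to \<open>y\<close>, and each larger one
  contributes more than \<open>ln y\<close> to \<open>psi n\<close>. The cut \<open>y\<close> is
  chosen later.\<close>

lemma card_odd_primes_upto_upper:
  fixes y :: real
  assumes "y > 1"
  shows "real (card (odd_primes_upto n)) \<le> y + psi n / ln y"
proof -
  let ?A = "{p\<in>odd_primes_upto n. real p \<le> y}" and ?B = "{p\<in>odd_primes_upto n. real p > y}"
  have "odd_primes_upto n = ?A \<union> ?B" by auto
  then have "card (odd_primes_upto n) \<le> card ?A + card ?B"
    using card_Un_le[of ?A ?B] by simp
  moreover have "?A \<subseteq> {1..nat \<lfloor>y\<rfloor>}"
    by (auto simp: odd_primes_upto_def Suc_le_eq prime_gt_0_nat le_nat_floor)
  then have "card ?A \<le> nat \<lfloor>y\<rfloor>" using card_mono[of "{1..nat \<lfloor>y\<rfloor>}" ?A] by simp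
  then have "real (card ?A) \<le> y" using assms by linarith
  moreover have "real (card ?B) * ln y \<le> psi n"
  proof -
    have "real (card ?B) * ln y = (\<Sum>p\<in>?B. ln y)" by simp
    also have "\<dots> \<le> (\<Sum>p\<in>?B. mangoldt p)"
      using assms by (intro sum_mono) (auto simp: odd_primes_upto_def)
    also have "\<dots> \<le> psi n"
      unfolding psi_def by (intro sum_mono2) (auto simp: odd_primes_upto_def mangoldt_nonneg)
    finally show ?thesis .
  qed
  then have "real (card ?B) \<le> psi n / ln y" using assms by (simp add: pos_le_divide_eq)
  ultimately show ?thesis by linarith
qed

text \<open>In \<open>q = p^k\<close> with \<open>k >= 2\<close> the base is at most
  \<open>sqrt n\<close> and the exponent at most \<open>log 2 n\<close>.\<close>

lemma card_proper_prime_powers_le: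
  assumes "n \<ge> 1"
  shows "real (card {q. primepow q \<and> \<not> prime q \<and> q \<le> n}) \<le> sqrt (real n) * log 2 (real n)"
proof -
  let ?Q = "{q. primepow q \<and> \<not> prime q \<and> q \<le> n}"
  let ?A = "{1..nat \<lfloor>sqrt (real n)\<rfloor>}" and ?B = "{1..nat \<lfloor>log 2 (real n)\<rfloor>}"
  have "?Q \<subseteq> (\<lambda>(p, k). p ^ k) ` (?A \<times> ?B)"
  proof
    fix q assume "q \<in> ?Q"
    then obtain p k where q: "q = p ^ k" "prime p" "k > 0" "\<not> prime q" "q \<le> n"
      by (auto simp: primepow_def)
    have "k \<noteq> 1" using q by auto
    then have "k \<ge> 2" using q by linarith
    have p: "p \<ge> 2" using q prime_ge_2_nat by blast
    have "p ^ 2 \<le> p ^ k" using p \<open>k \<ge> 2\<close> by (intro power_increasing) auto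
    then have "p ^ 2 \<le> n" using q by simp
    then have "real p \<le> sqrt (real n)"
      by (intro real_le_rsqrt) (metis of_nat_le_iff of_nat_power)
    moreover have "2 ^ k \<le> p ^ k" using p by (intro power_mono) auto
    then have "2 ^ k \<le> n" using q(1,5) by linarith
    then have "(2::real) ^ k \<le> real n" by (metis of_nat_le_iff of_nat_power of_nat_numeral)
    then have "real k \<le> log 2 (real n)" using assms by (simp add: le_log_iff powr_realpow)
    ultimately show "q \<in> (\<lambda>(p, k). p ^ k) ` (?A \<times> ?B)"
      using q p by (intro image_eqI[of _ _ "(p, k)"]) (auto simp: le_nat_floor)
  qed
  then have "card ?Q \<le> card (?A \<times> ?B)" by (rule surj_card_le[rotated]) auto
  then have "card ?Q \<le> nat \<lfloor>sqrt (real n)\<rfloor> * nat \<lfloor>log 2 (real n)\<rfloor>"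
    by (simp add: card_cartesian_product)
  then have "real (card ?Q) \<le> real (nat \<lfloor>sqrt (real n)\<rfloor>) * real (nat \<lfloor>log 2 (real n)\<rfloor>)"
    unfolding of_nat_mult[symmetric] by (rule of_nat_mono)
  also have "\<dots> \<le> sqrt (real n) * log 2 (real n)"
    using assms by (intro mult_mono of_nat_floor) auto
  finally show ?thesis .
qed

text \<open>Every term of \<open>psi n\<close> is at most \<open>ln n\<close>, and the nonzero ones
  sit at odd primes, at 2 (the summand 1) and at proper prime powers.\<close>

lemma psi_le_card_odd_primes_upto:
  assumes "n \<ge> 1"
  shows "psi n \<le> (real (card (odd_primes_upto n)) + 1 + sqrt (real n) * log 2 (real n)) * ln (real n)"
proof -
  let ?Q = "{q. primepow q \<and> \<not> prime q \<and> q \<le> n}"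
  let ?S = "odd_primes_upto n \<union> {2} \<union> ?Q"
  have fin: "finite ?Q" by (rule finite_subset[of _ "{..n}"]) auto
  have "psi n = (\<Sum>k\<in>{k. primepow k \<and> k \<le> n}. mangoldt k)"
    unfolding psi_def by (intro sum.mono_neutral_right) (auto simp: mangoldt_def)
  also have "\<dots> \<le> (\<Sum>k\<in>{k. primepow k \<and> k \<le> n}. ln (real n))"
  proof (rule sum_mono)
    fix k assume k: "k \<in> {k. primepow k \<and> k \<le> n}"
    then have "k > 0" by (auto intro: primepow_gt_0_nat)
    then show "mangoldt k \<le> ln (real n)" using k mangoldt_le_ln[of k] by (auto intro: order_trans)
  qed
  also have "\<dots> = real (card {k. primepow k \<and> k \<le> n}) * ln (real n)" by simp
  also have "\<dots> \<le> (real (card (odd_primes_upto n)) + 1 + sqrt (real n) * log 2 (real n)) * ln (real n)"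
  proof (rule mult_right_mono)
    have "{k. primepow k \<and> k \<le> n} \<subseteq> ?S"
      using primes_dvd_imp_eq[OF two_is_prime_nat] by (auto simp: odd_primes_upto_def)
    then have "card {k. primepow k \<and> k \<le> n} \<le> card ?S" using fin by (intro card_mono) auto
    also have "\<dots> \<le> card (odd_primes_upto n) + card {2::nat} + card ?Q"
      by (meson card_Un_le add_le_mono order_trans order_refl)
    finally show "real (card {k. primepow k \<and> k \<le> n}) \<le> real (card (odd_primes_upto n)) + 1 + sqrt (real n) * log 2 (real n)"
      using card_proper_prime_powers_le[OF assms] by simp
  qed (use assms in simp)
  finally show ?thesis .
qed

theorem card_odd_primes_upto_asymptotics:
  "(\<lambda>n. real (card (odd_primes_upto n)) * ln (real n) / real n) \<longlonglongrightarrow> 1"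
proof (rule tendsto_sandwich)
  let ?l = "\<lambda>n. psi n / real n - (1 + sqrt (real n) * log 2 (real n)) * ln (real n) / real n"
  \<comment> \<open>This cut is negligible against \<open>n / ln n\<close>, yet its logarithm is
    asymptotic to \<open>ln n\<close>.\<close>
  let ?y = "\<lambda>n. real n / (ln (real n))\<^sup>2"
  let ?u = "\<lambda>n. ?y n * ln (real n) / real n + psi n / real n * (ln (real n) / ln (?y n))"
  have "(\<lambda>n. (1 + sqrt (real n) * log 2 (real n)) * ln (real n) / real n) \<longlonglongrightarrow> 0"
    unfolding log_def by real_asymp
  from tendsto_diff[OF psi_asymptotics this] show "?l \<longlonglongrightarrow> 1" by simp
  have "(\<lambda>n. ?y n * ln (real n) / real n) \<longlonglongrightarrow> 0" by real_asymp
  moreover have "(\<lambda>n. ln (real n) / ln (?y n)) \<longlonglongrightarrow> 1" by real_asymp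
  ultimately have "?u \<longlonglongrightarrow> 0 + 1 * 1" by (intro tendsto_intros psi_asymptotics)
  then show "?u \<longlonglongrightarrow> 1" by simp
  show "\<forall>\<^sub>F n in sequentially. ?l n \<le> real (card (odd_primes_upto n)) * ln (real n) / real n"
    using eventually_ge_at_top[of 1]
  proof eventually_elim
    case (elim n)
    from divide_right_mono[OF psi_le_card_odd_primes_upto[OF elim], of "real n"]
    show ?case by (simp add: algebra_simps add_divide_distrib)
  qed
  have "filterlim ?y at_top sequentially" by real_asymp
  then have "\<forall>\<^sub>F n in sequentially. ?y n > 1" by (simp add: filterlim_at_top_dense)
  then show "\<forall>\<^sub>F n in sequentially. real (card (odd_primes_upto n)) * ln (real n) / real n \<le> ?u n"
    using eventually_ge_at_top[of 1]
  proof eventually_elim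
    case (elim n)
    have "real (card (odd_primes_upto n)) * (ln (real n) / real n) \<le> (?y n + psi n / ln (?y n)) * (ln (real n) / real n)"
      using elim by (intro mult_right_mono card_odd_primes_upto_upper) auto
    also have "(a + b / c) * (d / r) = a * d / r + b / r * (d / c)" for a b c d r :: real
      by (simp add: distrib_left add_divide_distrib mult.commute)
    finally show ?case by simp
  qed
qed

text \<open>For large \<open>j\<close>, weighting with \<open>ln N\<close> instead of
  \<open>ln j\<close> costs at most \<open>2 j / ln j\<close> times
  \<open>ln (N / j) <= N / j\<close>, that is \<open>2 N / ln j\<close>. The finitely many small
  \<open>j\<close> cost a multiple of \<open>ln N + 1\<close>.\<close>

lemma card_odd_primes_upto_uniform:
  fixes e :: real
  assumes e: "e > 0"
  shows "\<forall>\<^sub>F N in sequentially. \<forall>j\<le>N. \<bar>ln (real N) * real (card (odd_primes_upto j)) - real j\<bar> \<le> e * real N"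
proof -
  let ?c = "\<lambda>j. real (card (odd_primes_upto j))"
  \<comment> \<open>\<open>d <= e / 2\<close> spends half of the error on the asymptotics,
    \<open>d <= 1\<close> gives the factor 2 in the bound for the count, and the threshold
    \<open>4 / e\<close> for \<open>ln j\<close> turns \<open>2 / ln j\<close> into the other
    half.\<close>
  define d where "d = min 1 (e / 2)"
  have d: "d > 0" "d \<le> 1" "d \<le> e / 2" using e by (auto simp: d_def)
  have "\<forall>\<^sub>F j in sequentially. \<bar>?c j * ln (real j) / real j - 1\<bar> < d"
    using tendstoD[OF card_odd_primes_upto_asymptotics d(1)] by (simp add: dist_real_def)
  moreover have "\<forall>\<^sub>F j in sequentially. ln (real j) > 4 / e"
    using filterlim_compose[OF ln_at_top filterlim_real_sequentially] by (simp add: filterlim_at_top_dense)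
  ultimately have "\<forall>\<^sub>F j in sequentially. \<bar>?c j * ln (real j) / real j - 1\<bar> < d \<and> ln (real j) > 4 / e \<and> j \<ge> 1"
    using eventually_ge_at_top[of 1] by eventually_elim auto
  then obtain J where J: "\<And>j. j \<ge> J \<Longrightarrow> \<bar>?c j * ln (real j) / real j - 1\<bar> < d \<and> ln (real j) > 4 / e \<and> j \<ge> 1"
    by (auto simp: eventually_sequentially)
  have "(\<lambda>N. (ln (real N) + 1) * real J / real N) \<longlonglongrightarrow> 0" by real_asymp
  then have "\<forall>\<^sub>F N in sequentially. (ln (real N) + 1) * real J / real N < e"
    using e by (intro order_tendstoD)
  then show ?thesis using eventually_ge_at_top[of 1]
  proof eventually_elim
    case (elim N)
    show ?case
    proof (intro allI impI)
      fix j assume j: "j \<le> N"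
      have lnN: "ln (real N) \<ge> 0" using elim by simp
      show "\<bar>ln (real N) * ?c j - real j\<bar> \<le> e * real N"
      proof (cases "j < J")
        case True
        have "ln (real N) * ?c j \<le> ln (real N) * real J"
          using True card_odd_primes_upto_le[of j] lnN by (intro mult_left_mono) auto
        moreover have "0 \<le> ln (real N) * ?c j" using lnN by simp
        ultimately have "\<bar>ln (real N) * ?c j - real j\<bar> \<le> (ln (real N) + 1) * real J"
          using True by (simp add: distrib_right abs_le_iff)
        also have "\<dots> \<le> e * real N" using elim by (simp add: field_simps)
        finally show ?thesis .
      next
        case False
        then have *: "\<bar>?c j * ln (real j) / real j - 1\<bar> < d" "ln (real j) > 4 / e" "j \<ge> 1" using J by auto
        have jpos: "real j > 0" using * by simp
        have lnj: "ln (real j) > 0" using *(2) e by (meson divide_pos_pos less_trans zero_less_numeral)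
        have "\<bar>?c j * ln (real j) - real j\<bar> = \<bar>?c j * ln (real j) / real j - 1\<bar> * real j"
          using jpos by (simp add: field_simps flip: abs_mult_pos)
        also have "\<dots> \<le> d * real j" using * by (intro mult_right_mono) auto
        finally have near: "\<bar>?c j * ln (real j) - real j\<bar> \<le> d * real j" .
        have "d * real j \<le> 1 * real j" using d by (intro mult_right_mono) auto
        then have c: "?c j \<le> 2 * real j / ln (real j)" using near lnj by (simp add: pos_le_divide_eq)
        have "ln (real N) - ln (real j) = ln (real N / real j)" using jpos elim by (simp add: ln_div)
        also have "\<dots> \<le> real N / real j" using ln_le_minus_one[of "real N / real j"] jpos elim by simp
        finally have "?c j * (ln (real N) - ln (real j)) \<le> 2 * real j / ln (real j) * (real N / real j)"
          using c j jpos lnj by (intro mult_mono) auto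
        also have "\<dots> = real N * (2 / ln (real j))" using jpos by simp
        also have "\<dots> \<le> real N * (e / 2)"
          using *(2) lnj e by (intro mult_left_mono) (auto simp: field_simps)
        finally have up: "?c j * (ln (real N) - ln (real j)) \<le> e / 2 * real N" by (simp add: mult.commute)
        have "0 \<le> ?c j * (ln (real N) - ln (real j))" using j jpos by (intro mult_nonneg_nonneg) auto
        moreover have "d * real j \<le> e / 2 * real N" using d j by (intro mult_mono) auto
        moreover have "ln (real N) * ?c j - real j = (?c j * ln (real j) - real j) + ?c j * (ln (real N) - ln (real j))"
          by (simp add: algebra_simps)
        ultimately show ?thesis using near up by linarith
      qed
    qed
  qed
qed


text \<open>The sum of \<open>a k1 * ... * a km\<close> over all m-tuples of positive integers with
  sum at most \<open>M\<close>, organised by the first entry. For constant weight 1 it is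
  \<open>M choose m\<close>.\<close>

fun weighted_sums :: "(nat \<Rightarrow> real) \<Rightarrow> nat \<Rightarrow> nat \<Rightarrow> real" where
  "weighted_sums a 0 M = 1"
| "weighted_sums a (Suc m) M = (\<Sum>k=1..M. a k * weighted_sums a m (M - k))"

text \<open>Summation by parts: the decrements of \<open>v\<close>, together with its last value,
  add up to \<open>v 1\<close>.\<close>

lemma abel_sum_bound:
  fixes b v :: "nat \<Rightarrow> real"
  assumes K: "\<And>j. j \<le> M \<Longrightarrow> \<bar>\<Sum>k=1..j. b k\<bar> \<le> K"
    and dec: "\<And>k. 1 \<le> k \<Longrightarrow> k < M \<Longrightarrow> v (Suc k) \<le> v k" and nonneg: "v M \<ge> 0" and M: "1 \<le> M"
  shows "\<bar>\<Sum>k=1..M. b k * v k\<bar> \<le> K * v 1"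
proof -
  have "\<bar>(\<Sum>k=1..n. b k * v k) - (\<Sum>k=1..n. b k) * v n\<bar> \<le> K * (v 1 - v n)" if "1 \<le> n" "n \<le> M" for n
    using that
  proof (induction n rule: dec_induct)
    case (step n)
    have "\<bar>(\<Sum>k=1..n. b k) * (v n - v (Suc n))\<bar> \<le> K * (v n - v (Suc n))"
      using K[of n] dec[of n] step by (simp add: abs_mult mult_right_mono)
    moreover have "(\<Sum>k=1..Suc n. b k * v k) - (\<Sum>k=1..Suc n. b k) * v (Suc n)
        = ((\<Sum>k=1..n. b k * v k) - (\<Sum>k=1..n. b k) * v n) + (\<Sum>k=1..n. b k) * (v n - v (Suc n))"
      by (simp add: algebra_simps)
    moreover have "K * (v 1 - v (Suc n)) = K * (v 1 - v n) + K * (v n - v (Suc n))" by (simp add: algebra_simps)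
    moreover have "\<bar>(\<Sum>k=1..n. b k * v k) - (\<Sum>k=1..n. b k) * v n\<bar> \<le> K * (v 1 - v n)"
      using step by simp
    ultimately show ?case by linarith
  qed simp
  from this[of M] have "\<bar>(\<Sum>k=1..M. b k * v k) - (\<Sum>k=1..M. b k) * v M\<bar> \<le> K * (v 1 - v M)" using M by simp
  moreover have "\<bar>(\<Sum>k=1..M. b k) * v M\<bar> \<le> K * v M"
    using K[of M] nonneg by (simp add: abs_mult mult_right_mono)
  moreover have "K * (v 1 - v M) + K * v M = K * v 1" by (simp add: algebra_simps)
  ultimately show ?thesis by linarith
qed

text \<open>The hockey-stick identity, in the form of the recursion of \<open>weighted_sums\<close>
  for weight 1.\<close>

lemma sum_choose_diff: "(\<Sum>k=1..M. (M - k) choose m) = M choose Suc m"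
proof (cases M)
  case (Suc M')
  have "(\<Sum>k=1..M. (M - k) choose m) = (\<Sum>i<M. (M - Suc i) choose m)"
    by (simp add: sum.atLeast1_atMost_eq)
  also have "\<dots> = (\<Sum>i<M. i choose m)" by (rule sum.nat_diff_reindex)
  finally show ?thesis using sum_choose_upper[of m M'] Suc by (simp add: lessThan_Suc_atMost del: binomial_Suc_Suc)
qed simp

text \<open>Two replacements per step: the inner sums by binomials, where the induction hypothesis
  is multiplied by a total weight of at most \<open>2 * N\<close>, and then \<open>a k\<close> by 1,
  where \<open>abel_sum_bound\<close> applies because the binomials decrease in \<open>k\<close>.
  The constants obey \<open>c' = 2 * c + 1\<close>, hence \<open>2^m - 1\<close>.\<close>

lemma weighted_sums_approx:
  fixes a :: "nat \<Rightarrow> real" and e :: real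
  assumes a: "\<And>k. a k \<ge> 0" and e: "0 \<le> e" "e \<le> 1"
    and dev: "\<And>j. j \<le> N \<Longrightarrow> \<bar>(\<Sum>k=1..j. a k) - real j\<bar> \<le> e * real N"
  shows "M \<le> N \<Longrightarrow> \<bar>weighted_sums a m M - real (M choose m)\<bar> \<le> (2 ^ m - 1) * e * real N ^ m"
proof (induction m arbitrary: M)
  case (Suc m)
  let ?E = "(2 ^ m - 1) * e * real N ^ m"
  let ?v = "\<lambda>k. real ((M - k) choose m)"
  have "?E \<ge> 0" using e by simp
  have "(\<Sum>k=1..M. a k) \<le> real M + e * real N" using dev[OF Suc.prems] by linarith
  also have "\<dots> \<le> 2 * real N" using Suc.prems mult_right_mono[OF e(2), of "real N"] by simp
  finally have A: "(\<Sum>k=1..M. a k) \<le> 2 * real N" .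
  have "\<bar>\<Sum>k=1..M. a k * (weighted_sums a m (M - k) - ?v k)\<bar> \<le> (\<Sum>k=1..M. a k * ?E)"
    using Suc by (intro order_trans[OF sum_abs] sum_mono) (auto simp: abs_mult a intro!: mult_left_mono)
  also have "\<dots> = (\<Sum>k=1..M. a k) * ?E" by (simp add: sum_distrib_right)
  also have "\<dots> \<le> 2 * real N * ?E" using A \<open>?E \<ge> 0\<close> by (rule mult_right_mono)
  finally have 1: "\<bar>\<Sum>k=1..M. a k * (weighted_sums a m (M - k) - ?v k)\<bar> \<le> 2 * real N * ?E" .
  have 2: "\<bar>\<Sum>k=1..M. (a k - 1) * ?v k\<bar> \<le> e * real N * real N ^ m"
  proof (cases "M = 0")
    case False
    have "\<bar>\<Sum>k=1..M. (a k - 1) * ?v k\<bar> \<le> e * real N * ?v 1"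
    proof (rule abel_sum_bound)
      fix j assume "j \<le> M"
      then show "\<bar>\<Sum>k=1..j. a k - 1\<bar> \<le> e * real N" using dev[of j] Suc.prems by (simp add: sum_subtractf)
    next
      fix k show "?v (Suc k) \<le> ?v k" by (simp add: binomial_right_mono)
    qed (use False in auto)
    also have "?v 1 \<le> real N ^ m"
    proof (cases "m \<le> M - 1")
      case True
      then have "(M - 1) choose m \<le> (M - 1) ^ m" by (rule binomial_le_pow)
      also have "\<dots> \<le> N ^ m" using Suc.prems by (intro power_mono) auto
      finally show ?thesis by (metis of_nat_le_iff of_nat_power)
    qed (simp add: binomial_eq_0)
    then have "e * real N * ?v 1 \<le> e * real N * real N ^ m" using e by (intro mult_left_mono) auto
    finally show ?thesis .
  qed (use e in simp)
  have "(\<Sum>k=1..M. ?v k) = real (M choose Suc m)" unfolding sum_choose_diff[symmetric] by simp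
  then have "weighted_sums a (Suc m) M - real (M choose Suc m)
     = (\<Sum>k=1..M. a k * (weighted_sums a m (M - k) - ?v k)) + (\<Sum>k=1..M. (a k - 1) * ?v k)"
    by (simp add: sum.distrib[symmetric] sum_subtractf[symmetric] algebra_simps del: binomial_Suc_Suc
          flip: \<open>(\<Sum>k=1..M. ?v k) = real (M choose Suc m)\<close>)
  moreover have "2 * real N * ?E + e * real N * real N ^ m = (2 ^ Suc m - 1) * e * real N ^ Suc m"
    by (simp add: algebra_simps)
  ultimately show ?case using 1 2 by linarith
qed simp

section \<open>Tuples of odd primes with bounded sum\<close>

definition odd_prime_lists :: "nat \<Rightarrow> nat \<Rightarrow> nat list set" where
  "odd_prime_lists m M = {xs. length xs = m \<and> (\<forall>p\<in>set xs. prime p \<and> odd p) \<and> sum_list xs \<le> M}"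

lemma finite_odd_prime_lists: "finite (odd_prime_lists m M)"
proof (rule finite_subset)
  show "odd_prime_lists m M \<subseteq> {xs. set xs \<subseteq> {..M} \<and> length xs = m}"
    by (auto simp: odd_prime_lists_def dest: member_le_sum_list intro: order_trans)
qed (simp add: finite_lists_length_eq)

lemma card_odd_prime_lists_Suc:
  "card (odd_prime_lists (Suc m) M) = (\<Sum>p=1..M. if prime p \<and> odd p then card (odd_prime_lists m (M - p)) else 0)"
proof -
  let ?P = "{p \<in> {1..M}. prime p \<and> odd p}"
  have "odd_prime_lists (Suc m) M = (\<Union>p\<in>?P. (#) p ` odd_prime_lists m (M - p))"
  proof (intro equalityI subsetI)
    fix xs assume xs: "xs \<in> odd_prime_lists (Suc m) M"
    then obtain p ys where "xs = p # ys" by (cases xs) (auto simp: odd_prime_lists_def)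
    then have "p \<in> ?P" "ys \<in> odd_prime_lists m (M - p)"
      using xs by (auto simp: odd_prime_lists_def Suc_le_eq prime_gt_0_nat)
    then show "xs \<in> (\<Union>p\<in>?P. (#) p ` odd_prime_lists m (M - p))"
      using \<open>xs = p # ys\<close> by blast
  qed (auto simp: odd_prime_lists_def)
  also have "card \<dots> = (\<Sum>p\<in>?P. card ((#) p ` odd_prime_lists m (M - p)))"
    by (rule card_UN_disjoint) (auto simp: finite_odd_prime_lists)
  also have "\<dots> = (\<Sum>p\<in>?P. card (odd_prime_lists m (M - p)))"
    by (intro sum.cong refl card_image) (auto simp: inj_on_def)
  finally show ?thesis unfolding sum.inter_filter[OF finite_atLeastAtMost] .
qed

lemma weighted_sums_odd_primes:
  "weighted_sums (\<lambda>k. if prime k \<and> odd k then c else 0) m M = c ^ m * real (card (odd_prime_lists m M))"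
proof (induction m arbitrary: M)
  case 0
  have "odd_prime_lists 0 M = {[]}" by (auto simp: odd_prime_lists_def)
  then show ?case by simp
next
  case (Suc m)
  have "weighted_sums (\<lambda>k. if prime k \<and> odd k then c else 0) (Suc m) M
     = (\<Sum>p=1..M. c ^ Suc m * real (if prime p \<and> odd p then card (odd_prime_lists m (M - p)) else 0))"
    by (simp only: weighted_sums.simps Suc.IH) (intro sum.cong, auto)
  then show ?case by (simp add: card_odd_prime_lists_Suc sum_distrib_left of_nat_sum)
qed

lemma choose_over_power_tendsto: "(\<lambda>N. real (N choose m) / real N ^ m) \<longlonglongrightarrow> 1 / fact m"
proof (rule Lim_transform_eventually)
  have "(\<lambda>N. \<Prod>i<m. 1 - real i / real N) \<longlonglongrightarrow> (\<Prod>i<m. 1)"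
    by (intro tendsto_prod) real_asymp
  then have "(\<lambda>N. (\<Prod>i<m. 1 - real i / real N) / fact m) \<longlonglongrightarrow> (\<Prod>i<m. 1) / fact m"
    by (intro tendsto_divide tendsto_const) simp_all
  then show "(\<lambda>N. (\<Prod>i<m. 1 - real i / real N) / fact m) \<longlonglongrightarrow> 1 / fact m" by simp
  show "\<forall>\<^sub>F N in sequentially. (\<Prod>i<m. 1 - real i / real N) / fact m = real (N choose m) / real N ^ m"
    using eventually_gt_at_top[of 0]
  proof eventually_elim
    case (elim N)
    have "real (N choose m) = (\<Prod>i<m. real N - real i) / fact m"
      by (simp add: binomial_gbinomial gbinomial_prod_rev atLeast0LessThan)
    moreover have "(\<Prod>i<m. 1 - real i / real N) = (\<Prod>i<m. (real N - real i) / real N)"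
      using elim by (intro prod.cong) (auto simp: field_simps)
    ultimately show ?case by (simp add: prod_dividef)
  qed
qed

text \<open>Each \<open>N\<close> gets its own weight \<open>ln N\<close>; the weighted sum is then
  \<open>(ln N)^m\<close> times the number of tuples and differs from \<open>N choose m\<close> by
  \<open>o(N^m)\<close>.\<close>

lemma card_odd_prime_lists_asymptotics:
  "(\<lambda>N. real (card (odd_prime_lists m N)) * (ln (real N) / real N) ^ m) \<longlonglongrightarrow> 1 / fact m"
proof -
  let ?f = "\<lambda>N. real (card (odd_prime_lists m N)) * (ln (real N) / real N) ^ m"
  have "(\<lambda>N. ?f N - real (N choose m) / real N ^ m) \<longlonglongrightarrow> 0"
  proof (rule tendstoI)
    fix r :: real assume r: "r > 0"
    \<comment> \<open>Chosen so that \<open>(2^m - 1) * e < 2^m * e <= r\<close>.\<close>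
    define e where "e = min 1 (r / 2 ^ m)"
    have e: "e > 0" "e \<le> 1" "2 ^ m * e \<le> r" using r by (auto simp: e_def min_def field_simps)
    show "\<forall>\<^sub>F N in sequentially. dist (?f N - real (N choose m) / real N ^ m) 0 < r"
      using card_odd_primes_upto_uniform[OF e(1)] eventually_ge_at_top[of 1]
    proof eventually_elim
      case (elim N)
      let ?a = "\<lambda>k. if prime k \<and> odd k then ln (real N) else 0"
      have Npos: "real N ^ m > 0" using elim by simp
      have sum_a: "(\<Sum>k=1..j. ?a k) = ln (real N) * real (card (odd_primes_upto j))" for j
      proof -
        have "odd_primes_upto j = {k \<in> {1..j}. prime k \<and> odd k}"
          by (auto simp: odd_primes_upto_def Suc_le_eq prime_gt_0_nat)
        then have "(\<Sum>k\<in>odd_primes_upto j. ln (real N)) = (\<Sum>k=1..j. ?a k)"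
          by (simp only: sum.inter_filter[OF finite_atLeastAtMost])
        then show ?thesis by (simp add: mult.commute)
      qed
      have "\<bar>weighted_sums ?a m N - real (N choose m)\<bar> \<le> (2 ^ m - 1) * e * real N ^ m"
        using elim e by (intro weighted_sums_approx) (auto simp: sum_a[unfolded One_nat_def])
      also have "(2 ^ m - 1) * e * real N ^ m < r * real N ^ m"
        using Npos e by (intro mult_strict_right_mono) (auto simp: algebra_simps)
      finally have "\<bar>ln (real N) ^ m * real (card (odd_prime_lists m N)) - real (N choose m)\<bar> < r * real N ^ m"
        unfolding weighted_sums_odd_primes .
      then have "\<bar>ln (real N) ^ m * real (card (odd_prime_lists m N)) - real (N choose m)\<bar> / real N ^ m < r"
        using Npos by (simp add: pos_divide_less_eq)
      moreover have "?f N - real (N choose m) / real N ^ m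
          = (ln (real N) ^ m * real (card (odd_prime_lists m N)) - real (N choose m)) / real N ^ m"
        by (simp add: power_divide diff_divide_distrib mult.commute)
      ultimately show ?case using Npos by (simp add: dist_real_def abs_divide)
    qed
  qed
  from tendsto_add[OF this choose_over_power_tendsto[of m]] show ?thesis by simp
qed

section \<open>From tuples to partitions\<close>

lemma odd_prime_partitions_upto_eq:
  assumes "m > 0"
  shows "odd_prime_partitions_upto m n
    = {\<sigma>. size \<sigma> = m \<and> (\<forall>p \<in># \<sigma>. prime p \<and> odd p) \<and> \<Sum>\<^sub># \<sigma> \<le> n}"
proof -
  have "\<Sum>\<^sub># \<sigma> \<ge> 1" if "size \<sigma> = m" "\<forall>p \<in># \<sigma>. prime p \<and> odd p" for \<sigma> :: "nat multiset"
  proof -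
    have "\<sigma> \<noteq> {#}" using that(1) assms by auto
    then obtain p where "p \<in># \<sigma>" by auto
    then have "p \<le> \<Sum>\<^sub># \<sigma>" "p > 0" using that(2) by (auto simp: sum_mset.remove prime_gt_0_nat)
    then show ?thesis by linarith
  qed
  then show ?thesis unfolding odd_prime_partitions_upto_def odd_prime_partitions_def by fastforce
qed

lemma card_permutations_of_multiset_le: "card (permutations_of_multiset A) \<le> fact (size A)"
  by (simp add: card_permutations_of_multiset(1) div_le_dividend)

lemma card_permutations_of_multiset_distinct:
  assumes "\<And>x. count A x \<le> 1"
  shows "card (permutations_of_multiset A) = fact (size A)"
proof -
  have "fact (count A x) = (1::nat)" for x
    using assms[of x] by (metis fact_0 fact_1 le_antisym less_one linorder_not_less)
  then show ?thesis by (simp add: card_permutations_of_multiset(1))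
qed

text \<open>The lists are fibred over the partitions by \<open>mset\<close>, and a fibre consists of
  the orderings of its partition.\<close>

lemma card_odd_prime_lists_eq_sum:
  assumes "m > 0"
  shows "card (odd_prime_lists m n) = (\<Sum>\<sigma>\<in>odd_prime_partitions_upto m n. card (permutations_of_multiset \<sigma>))"
proof -
  have "odd_prime_lists m n = (\<Union>\<sigma>\<in>odd_prime_partitions_upto m n. permutations_of_multiset \<sigma>)"
    by (auto simp: odd_prime_lists_def odd_prime_partitions_upto_eq[OF assms] permutations_of_multiset_def
        sum_mset_sum_list)
  also have "card \<dots> = (\<Sum>\<sigma>\<in>odd_prime_partitions_upto m n. card (permutations_of_multiset \<sigma>))"
    by (rule card_UN_disjoint)
       (auto simp: finite_odd_prime_partitions_upto dest: permutations_of_multisetD)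
  finally show ?thesis .
qed

text \<open>If a repeated part is listed first and only once among its two copies, it is recovered
  as the head, so \<open>m - 1\<close> odd primes determine the partition. The missing entry saves a
  factor of order \<open>n / ln n\<close>.\<close>

lemma card_repeated_partitions_le:
  assumes m: "m \<ge> 2"
  shows "card {\<sigma> \<in> odd_prime_partitions_upto m n. \<exists>x. count \<sigma> x > 1} \<le> card (odd_primes_upto n) ^ (m - 1)"
proof -
  let ?L = "{xs. set xs \<subseteq> odd_primes_upto n \<and> length xs = m - 1}"
  have "{\<sigma> \<in> odd_prime_partitions_upto m n. \<exists>x. count \<sigma> x > 1} \<subseteq> (\<lambda>xs. mset (hd xs # xs)) ` ?L"
  proof
    fix \<sigma> assume "\<sigma> \<in> {\<sigma> \<in> odd_prime_partitions_upto m n. \<exists>x. count \<sigma> x > 1}"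
    then obtain p where p: "count \<sigma> p > 1" and \<sigma>: "size \<sigma> = m" "\<And>q. q \<in># \<sigma> \<Longrightarrow> prime q \<and> odd q" "\<Sum>\<^sub># \<sigma> \<le> n"
      using m by (auto simp: odd_prime_partitions_upto_eq)
    have le: "q \<le> n" if "q \<in># \<sigma>" for q using \<sigma>(3) that by (auto simp: sum_mset.remove)
    obtain ys where ys: "mset ys = \<sigma> - {#p, p#}" using ex_mset by blast
    have sub: "{#p, p#} \<subseteq># \<sigma>" using p by (auto simp: subseteq_mset_def)
    then have eq: "\<sigma> = mset (p # p # ys)" using ys by (simp add: subset_mset.add_diff_inverse)
         (metis add_mset_add_single subset_mset.diff_add union_mset_add_mset_right)
    have "set (p # ys) \<subseteq> odd_primes_upto n"
      using \<sigma>(2) le unfolding eq by (auto simp: odd_primes_upto_def)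
    moreover have "length (p # ys) = m - 1" using \<sigma>(1) unfolding eq by simp
    ultimately show "\<sigma> \<in> (\<lambda>xs. mset (hd xs # xs)) ` ?L"
      using eq by (intro image_eqI[of _ _ "p # ys"]) auto
  qed
  then have "card {\<sigma> \<in> odd_prime_partitions_upto m n. \<exists>x. count \<sigma> x > 1} \<le> card ?L"
    by (rule surj_card_le[rotated]) (simp add: finite_lists_length_eq)
  then show ?thesis by (simp add: card_lists_length_eq)
qed

text \<open>A fibre has at most \<open>fact m\<close> lists, and exactly that many when all parts
  differ; each partition with a repeated part is charged the full \<open>fact m\<close>.\<close>

lemma card_odd_prime_partitions_upto_bounds:
  assumes m: "m \<ge> 2"
  shows "card (odd_prime_lists m n) \<le> fact m * card (odd_prime_partitions_upto m n)"
    and "fact m * card (odd_prime_partitions_upto m n)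
          \<le> card (odd_prime_lists m n) + fact m * card (odd_primes_upto n) ^ (m - 1)"
proof -
  let ?U = "odd_prime_partitions_upto m n"
  let ?R = "{\<sigma> \<in> ?U. \<exists>x. count \<sigma> x > 1}"
  have size: "size \<sigma> = m" if "\<sigma> \<in> ?U" for \<sigma> using that m by (simp add: odd_prime_partitions_upto_eq)
  have T: "card (odd_prime_lists m n) = (\<Sum>\<sigma>\<in>?U. card (permutations_of_multiset \<sigma>))"
    using m by (intro card_odd_prime_lists_eq_sum) auto
  also have "\<dots> \<le> (\<Sum>\<sigma>\<in>?U. fact m)"
    by (rule sum_mono) (metis card_permutations_of_multiset_le size)
  finally show "card (odd_prime_lists m n) \<le> fact m * card ?U" by (simp add: mult.commute)
  have "fact m * card ?U = (\<Sum>\<sigma>\<in>?U. fact m)" by simp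
  also have "\<dots> \<le> (\<Sum>\<sigma>\<in>?U. card (permutations_of_multiset \<sigma>) + (if \<exists>x. count \<sigma> x > 1 then fact m else 0))"
  proof (rule sum_mono)
    fix \<sigma> assume \<sigma>: "\<sigma> \<in> ?U"
    show "fact m \<le> card (permutations_of_multiset \<sigma>) + (if \<exists>x. count \<sigma> x > 1 then fact m else 0)"
    proof (cases "\<exists>x. count \<sigma> x > 1")
      case False
      then have "card (permutations_of_multiset \<sigma>) = fact (size \<sigma>)"
        by (intro card_permutations_of_multiset_distinct) (simp add: not_less)
      then show ?thesis using size[OF \<sigma>] by simp
    qed auto
  qed
  also have "\<dots> = card (odd_prime_lists m n) + (\<Sum>\<sigma>\<in>?R. fact m)"
    unfolding sum.distrib T sum.inter_filter[OF finite_odd_prime_partitions_upto] ..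
  also have "(\<Sum>\<sigma>\<in>?R. fact m) = fact m * card ?R" by simp
  also have "card (odd_prime_lists m n) + fact m * card ?R
      \<le> card (odd_prime_lists m n) + fact m * card (odd_primes_upto n) ^ (m - 1)"
    using card_repeated_partitions_le[OF m, of n] by simp
  finally show "fact m * card ?U \<le> card (odd_prime_lists m n) + fact m * card (odd_primes_upto n) ^ (m - 1)" .
qed

text \<open>One factor \<open>fact m\<close> comes from \<open>N choose m\<close>, the other from
  forgetting the order of the parts.\<close>

lemma card_odd_prime_partitions_upto_asymptotics:
  assumes m: "m \<ge> 2"
  shows "(\<lambda>n. real (card (odd_prime_partitions_upto m n)) * (ln (real n) / real n) ^ m) \<longlonglongrightarrow> 1 / (fact m)\<^sup>2"
proof -
  let ?w = "\<lambda>n. (ln (real n) / real n)"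
  let ?U = "\<lambda>n. real (card (odd_prime_partitions_upto m n))"
  let ?T = "\<lambda>n. real (card (odd_prime_lists m n))"
  let ?P = "\<lambda>n. real (card (odd_primes_upto n))"
  have T: "(\<lambda>n. ?T n * ?w n ^ m) \<longlonglongrightarrow> 1 / fact m" by (rule card_odd_prime_lists_asymptotics)
  have "(\<lambda>n. ?U n * fact m * ?w n ^ m) \<longlonglongrightarrow> 1 / fact m"
  proof (rule tendsto_sandwich[OF _ _ T])
    have "?w \<longlonglongrightarrow> 0" by real_asymp
    then have "(\<lambda>n. ?T n * ?w n ^ m + fact m * (?P n * ln (real n) / real n) ^ (m - 1) * ?w n) \<longlonglongrightarrow> 1 / fact m + fact m * 1 ^ (m - 1) * 0"
      by (intro tendsto_intros T card_odd_primes_upto_asymptotics)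
    then show "(\<lambda>n. ?T n * ?w n ^ m + fact m * (?P n * ln (real n) / real n) ^ (m - 1) * ?w n) \<longlonglongrightarrow> 1 / fact m" by simp
    have w: "?w n ^ m \<ge> 0" for n by (cases "n = 0") auto
    have "?T n * ?w n ^ m \<le> ?U n * fact m * ?w n ^ m" for n
    proof (rule mult_right_mono[OF _ w])
      have "?T n \<le> real (fact m * card (odd_prime_partitions_upto m n))"
        using card_odd_prime_partitions_upto_bounds(1)[OF m, of n] by (rule of_nat_mono)
      then show "?T n \<le> ?U n * fact m" by (simp add: mult.commute)
    qed
    then show "\<forall>\<^sub>F n in sequentially. ?T n * ?w n ^ m \<le> ?U n * fact m * ?w n ^ m" by simp
    have "?U n * fact m * ?w n ^ m \<le> ?T n * ?w n ^ m + fact m * (?P n * ln (real n) / real n) ^ (m - 1) * ?w n" for n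
    proof -
      have "real (fact m * card (odd_prime_partitions_upto m n)) \<le> real (card (odd_prime_lists m n) + fact m * card (odd_primes_upto n) ^ (m - 1))"
        using card_odd_prime_partitions_upto_bounds(2)[OF m, of n] by (rule of_nat_mono)
      then have "?U n * fact m \<le> ?T n + fact m * ?P n ^ (m - 1)" by (simp add: mult.commute)
      then have "?U n * fact m * ?w n ^ m \<le> (?T n + fact m * ?P n ^ (m - 1)) * ?w n ^ m"
        by (rule mult_right_mono[OF _ w])
      also have pow: "?w n ^ m = ?w n ^ (m - 1) * ?w n"
        by (rule power_minus_mult[symmetric]) (use m in simp)
      also have "(t + f * p ^ j) * (w ^ j * w) = t * (w ^ j * w) + f * (p * w) ^ j * w"
        for t f p w :: real and j :: nat
        by (simp add: power_mult_distrib algebra_simps)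
      also note pow[symmetric]
      finally show ?thesis by simp
    qed
    then show "\<forall>\<^sub>F n in sequentially. ?U n * fact m * ?w n ^ m \<le> ?T n * ?w n ^ m + fact m * (?P n * ln (real n) / real n) ^ (m - 1) * ?w n" by simp
  qed
  then have "(\<lambda>n. ?U n * fact m * ?w n ^ m / fact m) \<longlonglongrightarrow> 1 / fact m / fact m"
    by (intro tendsto_divide tendsto_const) auto
  then show ?thesis by (simp add: power2_eq_square)
qed

text \<open>The event is itself the set of partitions up to \<open>k n\<close>, the floor of
  \<open>u * n\<close>, so the probability is a quotient of two counts. After normalisation both
  tend to the same nonzero limit, and what remains is the m-th power of a quantity tending to
  \<open>u\<close>.\<close>

theorem theorem4:
  fixes m :: nat and u :: real
  assumes "m > 2" and "0 < u" and "u < 1"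
  shows "(\<lambda>n. measure_pmf.prob (pmf_of_set (odd_prime_partitions_upto m n))
                {\<sigma>. real (\<Sum>\<^sub># \<sigma>) / real n \<le> u})
         \<longlonglongrightarrow> u ^ m"
proof (rule Lim_transform_eventually)
  let ?U = "\<lambda>n. real (card (odd_prime_partitions_upto m n))"
  let ?w = "\<lambda>n. ln (real n) / real n"
  define k where "k n = nat \<lfloor>u * real n\<rfloor>" for n :: nat
  define F where "F n = ?U n * ?w n ^ m" for n
  have F: "F \<longlonglongrightarrow> 1 / (fact m)\<^sup>2"
    unfolding F_def using assms by (intro card_odd_prime_partitions_upto_asymptotics) auto
  have k: "filterlim k at_top sequentially" "(\<lambda>n. real (k n) / real n) \<longlonglongrightarrow> u"
    unfolding k_def using filterlim_floor_scale[OF assms(2)] floor_scale_tendsto[OF assms(2)] .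
  have lnratio: "(\<lambda>n. ln (real n) / ln (real (k n))) \<longlonglongrightarrow> 1"
  proof (rule Lim_transform_eventually)
    have "filterlim (\<lambda>n. ln (real (k n))) at_top sequentially"
      by (intro filterlim_compose[OF ln_at_top] filterlim_compose[OF filterlim_real_sequentially k(1)])
    \<comment> \<open>The logarithm of \<open>k n / n\<close> tends to \<open>ln u\<close>, while
      \<open>ln (k n)\<close> tends to infinity.\<close>
    then have "(\<lambda>n. 1 - ln (real (k n) / real n) / ln (real (k n))) \<longlonglongrightarrow> 1 - 0"
      using assms
      by (intro tendsto_diff tendsto_const tendsto_divide_0[OF tendsto_ln[OF k(2)]])
         (auto intro: filterlim_at_top_imp_at_infinity)
    then show "(\<lambda>n. 1 - ln (real (k n) / real n) / ln (real (k n))) \<longlonglongrightarrow> 1" by simp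
    have "\<forall>\<^sub>F n in sequentially. k n \<ge> 2" using k(1) by (simp add: filterlim_at_top)
    then show "\<forall>\<^sub>F n in sequentially. 1 - ln (real (k n) / real n) / ln (real (k n)) = ln (real n) / ln (real (k n))"
      using eventually_gt_at_top[of 0]
    proof eventually_elim
      case (elim n)
      then have "ln (real (k n)) > 0" "ln (real (k n) / real n) = ln (real (k n)) - ln (real n)"
        by (auto simp: ln_div)
      then show ?case by (simp add: field_simps)
    qed
  qed
  have "(\<lambda>n. F (k n) / F n * (real (k n) / real n * (ln (real n) / ln (real (k n)))) ^ m)
      \<longlonglongrightarrow> 1 / (fact m)\<^sup>2 / (1 / (fact m)\<^sup>2) * (u * 1) ^ m"
    by (intro tendsto_intros filterlim_compose[OF F k(1)] F k(2) lnratio) auto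
  then show "(\<lambda>n. F (k n) / F n * (real (k n) / real n * (ln (real n) / ln (real (k n)))) ^ m) \<longlonglongrightarrow> u ^ m"
    by simp
  have "\<forall>\<^sub>F n in sequentially. k n \<ge> 2" using k(1) by (simp add: filterlim_at_top)
  then show "\<forall>\<^sub>F n in sequentially. F (k n) / F n * (real (k n) / real n * (ln (real n) / ln (real (k n)))) ^ m
      = measure_pmf.prob (pmf_of_set (odd_prime_partitions_upto m n)) {\<sigma>. real (\<Sum>\<^sub># \<sigma>) / real n \<le> u}"
    using eventually_ge_at_top[of "3 * m"]
  proof eventually_elim
    case (elim n)
    have n: "n \<ge> 2" using elim assms by linarith
    \<comment> \<open>From \<open>n >= 3 * m\<close> on the sample space is nonempty, so
      \<open>pmf_of_set\<close> really is the uniform distribution.\<close>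
    have ne: "odd_prime_partitions_upto m n \<noteq> {}"
      using elim assms by (intro odd_prime_partitions_upto_nonempty) auto
    have "odd_prime_partitions_upto m n \<inter> {\<sigma>. real (\<Sum>\<^sub># \<sigma>) / real n \<le> u} = odd_prime_partitions_upto m (k n)"
    proof -
      have iff: "real s / real n \<le> u \<longleftrightarrow> s \<le> k n" for s
        using n assms by (simp add: k_def pos_divide_le_eq le_nat_iff le_floor_iff)
      have "u * real n \<le> 1 * real n" using assms by (intro mult_right_mono) auto
      then have "k n \<le> n" using assms by (simp add: k_def) linarith
      then show ?thesis unfolding iff using assms by (auto simp: odd_prime_partitions_upto_eq)
    qed
    then have "measure_pmf.prob (pmf_of_set (odd_prime_partitions_upto m n)) {\<sigma>. real (\<Sum>\<^sub># \<sigma>) / real n \<le> u}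
        = ?U (k n) / ?U n"
      using measure_pmf_of_set[OF ne finite_odd_prime_partitions_upto] by simp
    also have "\<dots> = F (k n) / F n * (real (k n) / real n * (ln (real n) / ln (real (k n)))) ^ m"
    proof -
      have pos: "?w n > 0" "?w (k n) > 0" using n elim by auto
      have "real (k n) / real n * (ln (real n) / ln (real (k n))) = ?w n / ?w (k n)" by simp
      moreover have "a / b = a * x ^ m / (b * y ^ m) * (y / x) ^ m" if "x > 0" "y > 0" for a b x y :: real
        using that by (simp add: power_divide)
      ultimately show ?thesis using pos unfolding F_def by metis
    qed
    finally show ?case by simp
  qed
qed

end
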